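(* Let $G$ be a finite non-abelian $2$-group such that $G/G'$ is of type $(2,4)$, and let $M$ be the maximal subgroup of $G$ such that $M/G'$ is of type $(2,2)$. Then the following properties are equivalent: 1. $G$ is metacyclic; 2. $M/M'$ is of type $(2,2^m)$ with $m\geq 2$; 3. $d(M)=2$.
   Context: For a group $X$, $X'=[X,X]$ denotes its commutator subgroup and $d(X)$ the minimal number of generators of $X$. A finite abelian group is of type $(n_1,\dots,n_r)$ if it is isomorphic to $\mathbb{Z}/n_1\mathbb{Z}\times\cdots\times\mathbb{Z}/n_r\mathbb{Z}$. A group is metacyclic if it has a cyclic normal subgroup with cyclic quotient. *)

theory Defs
  imports "HOL-Algebra.Algebra"
begin

definition of_type :: "('a, 'b) monoid_scheme \<Rightarrow> nat list \<Rightarrow> bool" where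
  "of_type A ns \<longleftrightarrow> comm_group A \<and> finite (carrier A) \<and>
     A \<cong> product_group {..<length ns} (\<lambda>i. integer_mod_group (ns ! i))"

definition metacyclic_group :: "('a, 'b) monoid_scheme \<Rightarrow> bool" where
  "metacyclic_group G \<longleftrightarrow>
     (\<exists>N. N \<lhd> G \<and> cyclic_group (G\<lparr>carrier := N\<rparr>) \<and> cyclic_group (G Mod N))"

text \<open>The number below is meaningful for finitely generated groups only: otherwise the
  \<open>LEAST\<close> ranges over the empty set.\<close>

definition min_generators :: "('a, 'b) monoid_scheme \<Rightarrow> nat" where
  "min_generators G =
     (LEAST n. \<exists>S. S \<subseteq> carrier G \<and> finite S \<and> card S = n \<and> generate G S = carrier G)"

definition maximal_subgroup :: "'a set \<Rightarrow> ('a, 'b) monoid_scheme \<Rightarrow> bool" where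
  "maximal_subgroup M G \<longleftrightarrow> subgroup M G \<and> M \<noteq> carrier G \<and>
     (\<forall>H. subgroup H G \<longrightarrow> M \<subseteq> H \<longrightarrow> H = M \<or> H = carrier G)"

end

theory Submission
  imports Defs
begin

text \<open>The heart of the matter is the implication from \<open>d(M) = 2\<close> to metacyclicity. Let \<open>a, b\<close> lift
  generators of \<open>G/G'\<close> of orders 2 and 4, so that \<open>G = \<langle>a, b\<rangle>\<close> and \<open>M = \<langle>a, b\<^sup>2\<rangle>G'\<close>. Comparing orders,
  \<open>d(M) = 2\<close> forces \<open>G'\<close> to be generated by the squares of \<open>M\<close>. Put \<open>\<Phi> = \<Phi>(G')\<close> and
  \<open>R = [G', G]\<Phi>\<close>. Modulo \<open>R\<close> the group \<open>G'\<close> has order at most 2, \<open>M\<close> is abelian, and hence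
  \<open>G' = \<langle>s\<rangle>R\<close> with \<open>s = a\<^sup>2\<close> or \<open>s = b\<^sup>4\<close>. Modulo \<open>[R, G]\<Phi>\<close> the commutator \<open>[a, b]\<close> is a power of
  \<open>s\<close> times a central element; so it commutes with one of \<open>a, b\<close>, and then with the other one.
  Therefore \<open>R \<subseteq> [R, G]\<Phi>\<close>, nilpotency gives \<open>R \<subseteq> \<Phi>\<close>, and \<open>G' = \<langle>s\<rangle>\<close> by the Frattini argument.
  Now \<open>\<langle>a\<rangle>\<close> or \<open>\<langle>b\<rangle>\<close> contains \<open>G'\<close>, so it is normal with cyclic quotient. Moreover
  \<open>M' \<subseteq> R \<subseteq> \<Phi> \<noteq> G'\<close>; writing \<open>s = u\<^sup>2\<close> with \<open>u \<in> {a, b\<^sup>2}\<close>, the other element of \<open>{a, b\<^sup>2}\<close> differs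
  from an involution modulo \<open>M'\<close> by a power of \<open>u\<close>, whose order modulo \<open>M'\<close> is at least 4. Conversely,
  subgroups of metacyclic groups are 2-generated, and generators of \<open>M/M'\<close> lift to generators of
  \<open>M\<close>.\<close>

section \<open>Finite p-groups\<close>

text \<open>Every orbit is a single fixed point or has size divisible by \<open>p\<close>, so if
  \<open>x0\<close> were the only fixed point, \<open>card E\<close> would be 1 modulo
  \<open>p\<close>. The action is a bare function \<open>f\<close>, so that conjugation and coset
  translation can be plugged in directly.\<close>

lemma (in group) p_group_second_fixed_point:
  assumes "Factorial_Ring.prime (p::nat)" and ord: "order G = p ^ k" and finE: "finite E" and pE: "p dvd card E"
    and cl: "\<And>g x. g \<in> carrier G \<Longrightarrow> x \<in> E \<Longrightarrow> f g x \<in> E"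
    and one: "\<And>x. x \<in> E \<Longrightarrow> f \<one> x = x"
    and mult: "\<And>g h x. g \<in> carrier G \<Longrightarrow> h \<in> carrier G \<Longrightarrow> x \<in> E \<Longrightarrow> f (g \<otimes> h) x = f g (f h x)"
    and x0: "x0 \<in> E" and fix0: "\<And>g. g \<in> carrier G \<Longrightarrow> f g x0 = x0"
  shows "\<exists>x\<in>E. x \<noteq> x0 \<and> (\<forall>g\<in>carrier G. f g x = x)"
proof (rule ccontr)
  assume neg: "\<not> ?thesis"
  \<comment> \<open>\<open>Bij E\<close> contains extensional functions only, hence the restriction
    to \<open>E\<close>.\<close>
  define \<phi> where "\<phi> g = restrict (f g) E" for g
  have bij: "\<phi> g \<in> Bij E" if g: "g \<in> carrier G" for g
  proof -
    have "bij_betw (f g) E E"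
      by (rule bij_betw_byWitness[where f' = "f (inv g)"])
        (use g cl mult[of "inv g" g] mult[of g "inv g"] one in auto)
    then have "bij_betw (\<phi> g) E E"
      unfolding \<phi>_def by (subst bij_betw_cong[where g = "f g"]) auto
    then show ?thesis by (auto simp: Bij_def \<phi>_def)
  qed
  have "\<phi> \<in> hom G (BijGroup E)"
    by (rule homI) (use bij mult cl in \<open>auto simp: BijGroup_def compose_def \<phi>_def restrict_def\<close>)
  then interpret group_action G E \<phi>
    by (simp add: group_action_def group_hom_def group_hom_axioms_def group_BijGroup is_group)
  have finG: "finite (carrier G)"
    using ord \<open>Factorial_Ring.prime p\<close> by (metis order_gt_0_iff_finite prime_gt_0_nat zero_less_power)
  have orb_card: "p dvd card (orbit G \<phi> x)" if x: "x \<in> E" "x \<noteq> x0" for x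
  proof -
    have "card (orbit G \<phi> x) * card (stabilizer G \<phi> x) = p ^ k"
      using orbit_stabilizer_theorem[OF x(1)] ord by simp
    then have "card (orbit G \<phi> x) dvd p ^ k" by (metis dvd_triv_left)
    then obtain i where i: "card (orbit G \<phi> x) = p ^ i"
      using \<open>Factorial_Ring.prime p\<close> divides_primepow_nat by blast
    obtain g where g: "g \<in> carrier G" "f g x \<noteq> x" using neg x by blast
    have "{x, f g x} \<subseteq> orbit G \<phi> x"
      using orbit_refl[OF x(1)] g x by (auto simp: orbit_def \<phi>_def)
    moreover have "finite (orbit G \<phi> x)" using finG by (simp add: orbit_def)
    ultimately have "card {x, f g x} \<le> card (orbit G \<phi> x)" by (rule card_mono[rotated])
    then have "i \<noteq> 0" using i g by (cases i) auto
    then show ?thesis using i by (simp add: dvd_power)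
  qed
  have orb0: "orbit G \<phi> x0 = {x0}"
    using fix0 x0 one_closed by (force simp: orbit_def \<phi>_def)
  have "orbits G E \<phi> \<subseteq> Pow E"
    using orbits_coverture by auto
  then have fin: "finite (orbits G E \<phi>)" using finE by (metis finite_Pow_iff finite_subset)
  have x0in: "{x0} \<in> orbits G E \<phi>" using orb0 x0 unfolding orbits_def by blast
  have "card E = (\<Sum>orb\<in>orbits G E \<phi>. card orb)"
    using disjoint_sum[OF finE, of "\<lambda>_. 1::nat"] by simp
  also have "\<dots> = 1 + (\<Sum>orb\<in>orbits G E \<phi> - {{x0}}. card orb)"
    using sum.remove[OF fin x0in, of card] by simp
  finally have eq: "card E = 1 + (\<Sum>orb\<in>orbits G E \<phi> - {{x0}}. card orb)" .
  have "p dvd (\<Sum>orb\<in>orbits G E \<phi> - {{x0}}. card orb)"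
  proof (rule dvd_sum)
    fix orb assume "orb \<in> orbits G E \<phi> - {{x0}}"
    then obtain x where "x \<in> E" "orb = orbit G \<phi> x" "x \<noteq> x0"
      unfolding orbits_def using orb0 by blast
    then show "p dvd card orb" using orb_card by simp
  qed
  then have "p dvd 1" using eq pE by (metis dvd_add_left_iff)
  then show False using \<open>Factorial_Ring.prime p\<close> by simp
qed

lemma (in group) card_subgroup_p_group:
  assumes "Factorial_Ring.prime (p::nat)" and "order G = p ^ k" and "subgroup H G"
  shows "\<exists>i. card H = p ^ i"
  using assms lagrange[of H] divides_primepow_nat
  by (metis dvd_triv_right)

text \<open>The group acts on \<open>L\<close> by conjugation and fixes \<open>\<one>\<close>. The
  size of \<open>L\<close> is a positive power of \<open>p\<close>, so there is a second fixed
  point, and fixed points are central.\<close>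

lemma (in group) p_group_normal_meets_center:
  assumes p: "Factorial_Ring.prime (p::nat)" and ord: "order G = p ^ k" and L: "L \<lhd> G" "L \<noteq> {\<one>}"
  shows "\<exists>x\<in>L. x \<noteq> \<one> \<and> (\<forall>g\<in>carrier G. g \<otimes> x = x \<otimes> g)"
proof -
  interpret L: normal L G by fact
  obtain i where i: "card L = p ^ i"
    using card_subgroup_p_group[OF p ord L.is_subgroup] by blast
  have "finite L" using i p by (metis card_ge_0_finite prime_gt_0_nat zero_less_power)
  have "i \<noteq> 0"
    using i L(2) L.one_closed by (metis card_1_singletonE power_0 singletonD)
  have "\<exists>x\<in>L. x \<noteq> \<one> \<and> (\<forall>g\<in>carrier G. g \<otimes> x \<otimes> inv g = x)"
  proof (rule p_group_second_fixed_point[OF p ord \<open>finite L\<close>])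
    show "p dvd card L" using i \<open>i \<noteq> 0\<close> by (simp add: dvd_power)
  qed (use L.subset in \<open>auto simp: L.inv_op_closed2 m_assoc[symmetric] inv_mult_group subset_iff\<close>)
  then obtain x where x: "x \<in> L" "x \<noteq> \<one>" "\<And>g. g \<in> carrier G \<Longrightarrow> g \<otimes> x \<otimes> inv g = x"
    by blast
  have "g \<otimes> x = x \<otimes> g" if "g \<in> carrier G" for g
  proof -
    have "g \<otimes> x \<otimes> inv g \<otimes> g = x \<otimes> g" using x that by simp
    then show ?thesis using that L.subset x(1) by (simp add: m_assoc subset_iff)
  qed
  then show ?thesis using x by blast
qed

text \<open>The subgroup \<open>H\<close> acts on its cosets by right translation and fixes the
  coset \<open>H\<close>. Their number is a power of \<open>p\<close> greater than 1, so another
  coset \<open>H #> x\<close> is fixed, which means that \<open>x\<close> conjugates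
  \<open>H\<close> into itself.\<close>

lemma (in group) p_group_normalizer_grows:
  assumes p: "Factorial_Ring.prime (p::nat)" and ord: "order G = p ^ k" and H: "subgroup H G" "H \<noteq> carrier G"
  shows "\<exists>x\<in>carrier G - H. \<forall>h\<in>H. x \<otimes> h \<otimes> inv x \<in> H"
proof -
  interpret H: subgroup H G by fact
  obtain i where i: "card H = p ^ i" using card_subgroup_p_group[OF p ord H(1)] by blast
  have lag: "card (rcosets H) * card H = p ^ k" using lagrange[OF H(1)] ord by simp
  then obtain j where j: "card (rcosets H) = p ^ j"
    using divides_primepow_nat[OF p] by (metis dvd_triv_left)
  have finG: "finite (carrier G)"
    using ord p by (metis order_gt_0_iff_finite prime_gt_0_nat zero_less_power)
  have "j \<noteq> 0"
  proof
    assume "j = 0"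
    then have "card H = card (carrier G)" using lag j ord by (simp add: order_def)
    then show False using H finG H.subset card_subset_eq by blast
  qed
  interpret GH: group "G\<lparr>carrier := H\<rparr>" by (rule H.subgroup_is_group[OF is_group])
  \<comment> \<open>The inverse turns right translation into a left action, as the fixed point lemma
    requires.\<close>
  have "\<exists>C\<in>rcosets H. C \<noteq> H \<and> (\<forall>h\<in>carrier (G\<lparr>carrier := H\<rparr>). C #> inv h = C)"
  proof (rule GH.p_group_second_fixed_point[OF p, of i])
    show "order (G\<lparr>carrier := H\<rparr>) = p ^ i" using i by (simp add: order_def)
    show "finite (rcosets H)" using finG by (simp add: RCOSETS_def)
    show "p dvd card (rcosets H)" using j \<open>j \<noteq> 0\<close> by (simp add: dvd_power)
    show "C #> inv h \<in> rcosets H" if "h \<in> carrier (G\<lparr>carrier := H\<rparr>)" "C \<in> rcosets H" for h C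
      using that H.subset by (auto simp: RCOSETS_def coset_mult_assoc)
    show "C #> inv \<one>\<^bsub>G\<lparr>carrier := H\<rparr>\<^esub> = C" if "C \<in> rcosets H" for C
      using that H.subset by (auto simp: RCOSETS_def coset_mult_assoc)
    show "C #> inv (g \<otimes>\<^bsub>G\<lparr>carrier := H\<rparr>\<^esub> h) = C #> inv h #> inv g"
      if "g \<in> carrier (G\<lparr>carrier := H\<rparr>)" "h \<in> carrier (G\<lparr>carrier := H\<rparr>)" "C \<in> rcosets H" for g h C
    proof -
      obtain x where x: "x \<in> carrier G" "C = H #> x" using \<open>C \<in> rcosets H\<close> by (auto simp: RCOSETS_def)
      have gh: "g \<in> carrier G" "h \<in> carrier G" using that H.subset by auto
      then have "inv (g \<otimes> h) = inv h \<otimes> inv g" by (rule inv_mult_group)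
      then show ?thesis using x gh H.subset by (simp add: coset_mult_assoc m_assoc)
    qed
    show "H \<in> rcosets H" by (rule H.subgroup_in_rcosets[OF is_group])
    show "H #> inv g = H" if "g \<in> carrier (G\<lparr>carrier := H\<rparr>)" for g
      using that H.rcos_const[OF is_group] by simp
  qed
  then obtain x where x: "x \<in> carrier G" "H #> x \<noteq> H" "\<And>h. h \<in> H \<Longrightarrow> H #> x #> inv h = H #> x"
    by (auto simp: RCOSETS_def)
  have "x \<otimes> h \<otimes> inv x \<in> H" if h: "h \<in> H" for h
  proof -
    have "H #> x #> inv (inv h) = H #> x" using x(3) h by blast
    then have "x \<otimes> h \<in> H #> x"
      using h x(1) H.subset rcos_self[OF _ H(1), of "x \<otimes> h"] by (auto simp: coset_mult_assoc)
    then show ?thesis using H.rcos_module_imp[OF is_group x(1)] by blast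
  qed
  moreover have "x \<notin> H" using x(2) H.rcos_const[OF is_group] by blast
  ultimately show ?thesis using x(1) by blast
qed

text \<open>For a finite 2-group \<open>H\<close> this is the Frattini subgroup: commutators are
  products of squares, so squares alone suffice as generators.\<close>

definition squares_generated :: "('a, 'b) monoid_scheme \<Rightarrow> 'a set \<Rightarrow> 'a set" where
  "squares_generated G H = generate G ((\<lambda>x. x \<otimes>\<^bsub>G\<^esub> x) ` H)"

text \<open>\<open>comm_ext G L N\<close> stands for \<open>[L, G]N\<close>.\<close>

definition comm_ext :: "('a, 'b) monoid_scheme \<Rightarrow> 'a set \<Rightarrow> 'a set \<Rightarrow> 'a set" where
  "comm_ext G L N = generate G
     ((\<lambda>(x, g). x \<otimes>\<^bsub>G\<^esub> g \<otimes>\<^bsub>G\<^esub> inv\<^bsub>G\<^esub> x \<otimes>\<^bsub>G\<^esub> inv\<^bsub>G\<^esub> g) ` (L \<times> carrier G) \<union> N)"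

section \<open>Subgroups generated by squares or commutators, nilpotency, Frattini arguments\<close>

context group
begin

lemma coset_hom: "N \<lhd> G \<Longrightarrow> group_hom G (G Mod N) (\<lambda>x. N #> x)"
  by (intro group_hom.intro group_hom_axioms.intro is_group normal.factorgroup_is_group
      normal.r_coset_hom_Mod)

lemma mult_inv_cancel_left [simp]:
  assumes "x \<in> carrier G" "y \<in> carrier G"
  shows "x \<otimes> (inv x \<otimes> y) = y" "inv x \<otimes> (x \<otimes> y) = y"
  using assms by (simp_all add: m_assoc[symmetric])

lemma coset_eq_iff:
  assumes "subgroup N G" "x \<in> carrier G"
  shows "N #> x = N \<longleftrightarrow> x \<in> N"
  using assms coset_join1 subgroup.rcos_const subgroup.subset is_group by metis

lemma commutator_eq_one_iff:
  assumes "x \<in> carrier G" "y \<in> carrier G"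
  shows "x \<otimes> y \<otimes> inv x \<otimes> inv y = \<one> \<longleftrightarrow> x \<otimes> y = y \<otimes> x"
proof
  assume "x \<otimes> y \<otimes> inv x \<otimes> inv y = \<one>"
  then have "x \<otimes> y \<otimes> inv x = y"
    using assms by (metis inv_closed inv_equality inv_inv m_closed)
  then show "x \<otimes> y = y \<otimes> x"
    using assms by (metis inv_solve_right' m_closed)
next
  assume "x \<otimes> y = y \<otimes> x"
  then show "x \<otimes> y \<otimes> inv x \<otimes> inv y = \<one>"
    using assms by (simp add: m_assoc[symmetric]) (simp add: m_assoc)
qed

text \<open>The coset of a commutator is the commutator of the cosets, which is trivial exactly when
  they commute.\<close>

lemma commutator_mem_iff:
  assumes N: "N \<lhd> G" and x: "x \<in> carrier G" and y: "y \<in> carrier G"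
  shows "x \<otimes> y \<otimes> inv x \<otimes> inv y \<in> N \<longleftrightarrow>
    (N #> x) \<otimes>\<^bsub>G Mod N\<^esub> (N #> y) = (N #> y) \<otimes>\<^bsub>G Mod N\<^esub> (N #> x)"
proof -
  interpret h: group_hom G "G Mod N" "\<lambda>x. N #> x" using coset_hom[OF N] .
  have "x \<otimes> y \<otimes> inv x \<otimes> inv y \<in> N \<longleftrightarrow> N #> (x \<otimes> y \<otimes> inv x \<otimes> inv y) = \<one>\<^bsub>G Mod N\<^esub>"
    using coset_eq_iff[OF normal_imp_subgroup[OF N], of "x \<otimes> y \<otimes> inv x \<otimes> inv y"] x y
    by (simp only: one_FactGroup m_closed inv_closed)
  also have "\<dots> \<longleftrightarrow> (N #> x) \<otimes>\<^bsub>G Mod N\<^esub> (N #> y) \<otimes>\<^bsub>G Mod N\<^esub> inv\<^bsub>G Mod N\<^esub> (N #> x)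
       \<otimes>\<^bsub>G Mod N\<^esub> inv\<^bsub>G Mod N\<^esub> (N #> y) = \<one>\<^bsub>G Mod N\<^esub>"
    using x y by (simp only: h.hom_mult h.hom_inv m_closed inv_closed)
  also have "\<dots> \<longleftrightarrow> (N #> x) \<otimes>\<^bsub>G Mod N\<^esub> (N #> y) = (N #> y) \<otimes>\<^bsub>G Mod N\<^esub> (N #> x)"
    by (rule h.H.commutator_eq_one_iff) (use x y h.hom_closed in auto)
  finally show ?thesis .
qed

text \<open>The elements commuting with \<open>z\<close> are closed under products and
  inverses.\<close>

lemma generate_commute:
  assumes "S \<subseteq> carrier G" "z \<in> carrier G" "\<And>s. s \<in> S \<Longrightarrow> s \<otimes> z = z \<otimes> s" "x \<in> generate G S"
  shows "x \<otimes> z = z \<otimes> x"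
  using assms(4)
proof induction
  case (inv h)
  then have h: "h \<in> carrier G" "h \<otimes> z = z \<otimes> h" using assms by auto
  have "inv h \<otimes> z = inv h \<otimes> (z \<otimes> h) \<otimes> inv h"
    using h(1) assms(2) by (simp add: m_assoc)
  also have "\<dots> = inv h \<otimes> (h \<otimes> z) \<otimes> inv h" by (simp only: h(2))
  also have "\<dots> = z \<otimes> inv h" using h(1) assms(2) by simp
  finally show ?case .
next
  case (eng h1 h2)
  then have h: "h1 \<in> carrier G" "h2 \<in> carrier G" using generate_in_carrier[OF assms(1)] by auto
  have "h1 \<otimes> h2 \<otimes> z = h1 \<otimes> (z \<otimes> h2)" using h assms(2) by (simp add: m_assoc eng.IH(2)[symmetric])
  also have "\<dots> = (h1 \<otimes> z) \<otimes> h2" using h assms(2) by (simp only: m_assoc)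
  also have "\<dots> = z \<otimes> (h1 \<otimes> h2)" by (simp only: eng.IH(1)) (use h assms(2) in \<open>simp add: m_assoc\<close>)
  finally show ?case .
qed (use assms in auto)

text \<open>A conjugate of a square is the square of a conjugate, so the generating set is already
  invariant.\<close>

lemma squares_generated_normal:
  assumes "H \<lhd> G"
  shows "squares_generated G H \<lhd> G"
proof -
  interpret H: normal H G by fact
  show ?thesis
    unfolding squares_generated_def
  proof (rule normal_generateI)
    fix h g assume "h \<in> (\<lambda>x. x \<otimes> x) ` H" and g: "g \<in> carrier G"
    then obtain x where x: "x \<in> H" "h = x \<otimes> x" by blast
    then have "g \<otimes> h \<otimes> inv g = (g \<otimes> x \<otimes> inv g) \<otimes> (g \<otimes> x \<otimes> inv g)"
      using g H.subset by (simp add: m_assoc subset_iff)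
    then show "g \<otimes> h \<otimes> inv g \<in> (\<lambda>x. x \<otimes> x) ` H" using H.inv_op_closed2 g x by blast
  qed (use H.subset in auto)
qed

lemma squares_generated_subset:
  assumes "subgroup H G" shows "squares_generated G H \<subseteq> H"
  unfolding squares_generated_def
  by (rule generate_subgroup_incl[OF _ assms]) (use assms subgroup.m_closed in fastforce)

lemma square_mem_squares_generated: "x \<in> H \<Longrightarrow> x \<otimes> x \<in> squares_generated G H"
  unfolding squares_generated_def by (rule generate.incl) blast

lemma squares_generated_consistent:
  assumes "subgroup H G"
  shows "squares_generated (G\<lparr>carrier := H\<rparr>) H = squares_generated G H"
  unfolding squares_generated_def using assms
  by (simp, subst generate_consistent) (auto intro: subgroup.m_closed)

lemma comm_ext_normal:
  assumes "L \<lhd> G" "N \<lhd> G"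
  shows "comm_ext G L N \<lhd> G"
proof -
  interpret L: normal L G by fact
  interpret N: normal N G by fact
  show ?thesis
    unfolding comm_ext_def
  proof (rule normal_generateI)
    fix h g assume "h \<in> (\<lambda>(x, g). x \<otimes> g \<otimes> inv x \<otimes> inv g) ` (L \<times> carrier G) \<union> N"
      and g: "g \<in> carrier G"
    then consider "h \<in> N" | x y where "x \<in> L" "y \<in> carrier G" "h = x \<otimes> y \<otimes> inv x \<otimes> inv y"
      by auto
    then show "g \<otimes> h \<otimes> inv g \<in> (\<lambda>(x, g). x \<otimes> g \<otimes> inv x \<otimes> inv g) ` (L \<times> carrier G) \<union> N"
    proof cases
      case 1
      then show ?thesis using N.inv_op_closed2 g by blast
    next
      case 2
      have x: "x \<in> carrier G" using 2 L.subset by auto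
      let ?x = "g \<otimes> x \<otimes> inv g" and ?y = "g \<otimes> y \<otimes> inv g"
      have "g \<otimes> h \<otimes> inv g = ?x \<otimes> ?y \<otimes> inv ?x \<otimes> inv ?y"
        using x 2 g by (simp add: m_assoc inv_mult_group)
      moreover have "?x \<in> L" "?y \<in> carrier G" using L.inv_op_closed2 2 g by auto
      ultimately show ?thesis by (intro UnI1 image_eqI[where x = "(?x, ?y)"]) auto
    qed
  qed (use L.subset N.subset in auto)
qed

lemma commutator_mem_comm_ext:
  "x \<in> L \<Longrightarrow> g \<in> carrier G \<Longrightarrow> x \<otimes> g \<otimes> inv x \<otimes> inv g \<in> comm_ext G L N"
  unfolding comm_ext_def by (rule generate.incl) force

lemma subset_comm_ext: "N \<subseteq> comm_ext G L N"
  unfolding comm_ext_def by (intro subsetI generate.incl UnI2)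

lemma comm_ext_subset:
  assumes "subgroup K G" "N \<subseteq> K"
    and "\<And>x g. x \<in> L \<Longrightarrow> g \<in> carrier G \<Longrightarrow> x \<otimes> g \<otimes> inv x \<otimes> inv g \<in> K"
  shows "comm_ext G L N \<subseteq> K"
  unfolding comm_ext_def
proof (rule generate_subgroup_incl[OF _ assms(1)])
  show "(\<lambda>(x, g). x \<otimes> g \<otimes> inv x \<otimes> inv g) ` (L \<times> carrier G) \<union> N \<subseteq> K"
    using assms(2,3) by (intro Un_least image_subsetI) (simp_all add: case_prod_beta mem_Times_iff)
qed

text \<open>This is the form in which nilpotency is used: \<open>L\<close> cannot survive modulo
  \<open>N\<close> if it equals its own commutators with \<open>G\<close> there. Otherwise take
  \<open>K\<close> maximal among the normal subgroups above \<open>N\<close> that do not contain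
  \<open>L\<close>. The image of \<open>L\<close> modulo \<open>K\<close> contains a nontrivial
  central element, and adjoining it to \<open>K\<close> already captures \<open>L\<close>, so
  \<open>L\<close> is central modulo \<open>K\<close>.\<close>

lemma p_group_subset_comm_ext:
  assumes p: "Factorial_Ring.prime (p::nat)" and ord: "order G = p ^ k"
    and L: "L \<lhd> G" and N: "N \<lhd> G" and sub: "L \<subseteq> comm_ext G L N"
  shows "L \<subseteq> N"
proof (rule ccontr)
  assume nsub: "\<not> L \<subseteq> N"
  have finG: "finite (carrier G)"
    using ord p by (metis order_gt_0_iff_finite prime_gt_0_nat zero_less_power)
  define \<K> where "\<K> = {K. K \<lhd> G \<and> N \<subseteq> K \<and> \<not> L \<subseteq> K}"
  have "\<K> \<subseteq> Pow (carrier G)"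
    using normal_imp_subgroup subgroup.subset by (fastforce simp: \<K>_def)
  then have "finite \<K>" using finG by (metis finite_Pow_iff finite_subset)
  moreover have "\<K> \<noteq> {}" using nsub N by (auto simp: \<K>_def)
  ultimately obtain K where K: "K \<in> \<K>" and max: "\<And>K'. K' \<in> \<K> \<Longrightarrow> K \<subseteq> K' \<Longrightarrow> K' = K"
    using finite_has_maximal[of \<K>] by metis
  interpret K: normal K G using K by (simp add: \<K>_def)
  interpret L: normal L G by fact
  interpret h: group_hom G "G Mod K" "\<lambda>x. K #> x" using coset_hom[OF K.normal_axioms] .
  have surj: "(\<lambda>x. K #> x) ` carrier G = carrier (G Mod K)" by (simp add: carrier_FactGroup)
  have Q: "(\<lambda>x. K #> x) ` L \<lhd> G Mod K"
    using L.surj_hom_normal_subgroup[OF h.group_hom_axioms surj] .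
  have "order (G Mod K) * card K = p ^ k"
    using lagrange[OF K.is_subgroup] ord by (simp add: order_def FactGroup_def)
  then obtain i where i: "order (G Mod K) = p ^ i"
    using divides_primepow_nat[OF p] by (metis dvd_triv_left)
  have "(\<lambda>x. K #> x) ` L \<noteq> {\<one>\<^bsub>G Mod K\<^esub>}"
  proof
    assume eq: "(\<lambda>x. K #> x) ` L = {\<one>\<^bsub>G Mod K\<^esub>}"
    have "x \<in> K" if x: "x \<in> L" for x
    proof -
      have "K #> x \<in> {\<one>\<^bsub>G Mod K\<^esub>}" unfolding eq[symmetric] using x by (rule imageI)
      then have "K #> x = K" by simp
      then show ?thesis using coset_eq_iff[OF K.is_subgroup] x L.subset by blast
    qed
    then have "L \<subseteq> K" by blast
    then show False using K by (simp add: \<K>_def)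
  qed
  then obtain x where x: "x \<in> L" "K #> x \<noteq> K"
    and cent: "\<And>g. g \<in> carrier (G Mod K) \<Longrightarrow> g \<otimes>\<^bsub>G Mod K\<^esub> (K #> x) = (K #> x) \<otimes>\<^bsub>G Mod K\<^esub> g"
    using h.H.p_group_normal_meets_center[OF p i Q] by auto
  have xG: "x \<in> carrier G" using x L.subset by auto
  \<comment> \<open>The preimage in \<open>G\<close> of the centre of
    \<open>G Mod K\<close>.\<close>
  define Z where "Z = {z \<in> carrier G. \<forall>g\<in>carrier G. z \<otimes> g \<otimes> inv z \<otimes> inv g \<in> K}"
  have Z_iff: "z \<in> Z \<longleftrightarrow> z \<in> carrier G \<and>
     (\<forall>g\<in>carrier G. (K #> z) \<otimes>\<^bsub>G Mod K\<^esub> (K #> g) = (K #> g) \<otimes>\<^bsub>G Mod K\<^esub> (K #> z))" for z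
    unfolding Z_def using commutator_mem_iff[OF K.normal_axioms] by auto
  have K_Z: "y \<in> Z" if "y \<in> generate G (insert x K)" for y
  proof -
    have yG: "y \<in> carrier G" by (rule generate_in_carrier[OF _ that]) (use xG K.subset in auto)
    have gy: "K #> y \<in> generate (G Mod K) ((\<lambda>x. K #> x) ` insert x K)"
      using h.generate_img[of "insert x K"] that xG K.subset by blast
    have comm: "s \<otimes>\<^bsub>G Mod K\<^esub> (K #> g) = (K #> g) \<otimes>\<^bsub>G Mod K\<^esub> s"
      if "s \<in> (\<lambda>x. K #> x) ` insert x K" "g \<in> carrier G" for s g
    proof -
      from that(1) obtain u where u: "u \<in> insert x K" "s = K #> u" by (rule imageE)
      from u(1) show ?thesis
      proof (rule insertE)
        assume "u = x"
        then show ?thesis using cent[of "K #> g"] h.hom_closed[OF that(2)] u(2) by (simp only:)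
      next
        assume "u \<in> K"
        then have "s = \<one>\<^bsub>G Mod K\<^esub>" using coset_eq_iff[OF K.is_subgroup, of u] u(2) K.subset by auto
        then show ?thesis using h.H.l_one[of "K #> g"] h.H.r_one[of "K #> g"] h.hom_closed[OF that(2)]
          by (simp only:)
      qed
    qed
    have "(\<lambda>x. K #> x) ` insert x K \<subseteq> carrier (G Mod K)"
      using xG K.subset by (intro image_subsetI h.hom_closed) auto
    then have "(K #> y) \<otimes>\<^bsub>G Mod K\<^esub> (K #> g) = (K #> g) \<otimes>\<^bsub>G Mod K\<^esub> (K #> y)"
      if g: "g \<in> carrier G" for g
      using h.H.generate_commute[OF _ h.hom_closed[OF g] comm[OF _ g] gy] by blast
    then show ?thesis using yG Z_iff by blast
  qed
  \<comment> \<open>All its elements are central modulo \<open>K\<close>, so a conjugate of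
    \<open>y\<close> differs from \<open>y\<close> by an element of \<open>K\<close>.\<close>
  have "generate G (insert x K) \<lhd> G"
  proof (rule normal_invI)
    show sg: "subgroup (generate G (insert x K)) G"
      by (rule generate_is_subgroup) (use xG K.subset in auto)
    fix g y assume g: "g \<in> carrier G" and y: "y \<in> generate G (insert x K)"
    have yG: "y \<in> carrier G" using y subgroup.subset[OF sg] by auto
    have iy: "inv y \<in> generate G (insert x K)" using subgroup.m_inv_closed[OF sg y] .
    then have "inv y \<otimes> g \<otimes> inv (inv y) \<otimes> inv g \<in> K" using K_Z g unfolding Z_def by blast
    then have "inv y \<otimes> g \<otimes> inv (inv y) \<otimes> inv g \<in> generate G (insert x K)"
      by (intro generate.incl) auto
    then have "y \<otimes> (inv y \<otimes> g \<otimes> inv (inv y) \<otimes> inv g) \<in> generate G (insert x K)"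
      using subgroup.m_closed[OF sg y] by blast
    also have "y \<otimes> (inv y \<otimes> g \<otimes> inv (inv y) \<otimes> inv g) = g \<otimes> y \<otimes> inv g"
      using yG g by (simp add: m_assoc)
    finally show "g \<otimes> y \<otimes> inv g \<in> generate G (insert x K)" .
  qed
  moreover have KM: "K \<subseteq> generate G (insert x K)" and xM: "x \<in> generate G (insert x K)"
    using generate.incl[of _ "insert x K" G] by blast+
  moreover have "generate G (insert x K) \<noteq> K"
    using xM x(2) coset_eq_iff[OF K.is_subgroup xG] by blast
  moreover have NK: "N \<subseteq> K" "\<not> L \<subseteq> K" using K by (simp_all add: \<K>_def)
  ultimately have LM: "L \<subseteq> generate G (insert x K)"
    using max[of "generate G (insert x K)"] unfolding \<K>_def by blast
  \<comment> \<open>Since \<open>L\<close> is central modulo \<open>K\<close> and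
    \<open>N \<subseteq> K\<close>, the assumption \<open>sub\<close> forces
    \<open>L \<subseteq> K\<close>, against the choice of \<open>K\<close>.\<close>
  have "comm_ext G L N \<subseteq> K"
  proof (rule comm_ext_subset[OF K.is_subgroup NK(1)])
    fix y g assume "y \<in> L" "g \<in> carrier G"
    then show "y \<otimes> g \<otimes> inv y \<otimes> inv g \<in> K" using K_Z LM unfolding Z_def by blast
  qed
  then show False using NK sub by blast
qed

text \<open>A maximal proper subgroup \<open>K\<close> above \<open>H\<close> has index 2, because
  its normalizer is larger than \<open>K\<close>; hence it contains all squares.\<close>

lemma two_group_proper_subgroup_squares:
  assumes ord: "order G = 2 ^ k" and H: "subgroup H G" "H \<noteq> carrier G"
  shows "\<exists>K. subgroup K G \<and> H \<subseteq> K \<and> K \<noteq> carrier G \<and> (\<forall>x\<in>carrier G. x \<otimes> x \<in> K)"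
proof -
  have finG: "finite (carrier G)" using ord by (metis order_gt_0_iff_finite zero_less_numeral zero_less_power)
  define \<K> where "\<K> = {K. subgroup K G \<and> H \<subseteq> K \<and> K \<noteq> carrier G}"
  have "\<K> \<subseteq> Pow (carrier G)" using subgroup.subset by (fastforce simp: \<K>_def)
  then have "finite \<K>" using finG by (metis finite_Pow_iff finite_subset)
  moreover have "\<K> \<noteq> {}" using H by (auto simp: \<K>_def)
  ultimately obtain K where K: "K \<in> \<K>" and max: "\<And>K'. K' \<in> \<K> \<Longrightarrow> K \<subseteq> K' \<Longrightarrow> K' = K"
    using finite_has_maximal[of \<K>] by metis
  interpret K: subgroup K G using K by (simp add: \<K>_def)
  obtain x where x: "x \<in> carrier G" "x \<notin> K" and xK: "\<And>h. h \<in> K \<Longrightarrow> x \<otimes> h \<otimes> inv x \<in> K"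
    using p_group_normalizer_grows[OF two_is_prime_nat ord, of K] K by (auto simp: \<K>_def)
  \<comment> \<open>Repeated squaring of \<open>x\<close> reaches \<open>\<one>\<close>, since the
    order of \<open>G\<close> is a power of 2. The term \<open>z\<close> just before the sequence
    first enters \<open>K\<close> lies outside \<open>K\<close> and has its square inside.\<close>
  define P where "P i = x [^] (2 ^ i :: nat)" for i :: nat
  have P_Suc: "P (Suc i) = P i \<otimes> P i" for i
    using x by (simp add: P_def nat_pow_mult mult_2)
  have PG: "P i \<in> carrier G" for i using x by (simp add: P_def)
  have "P k = \<one>" unfolding P_def using pow_order_eq_1[OF x(1)] ord by simp
  then have ex: "\<exists>i. P i \<in> K" by (metis K.one_closed)
  define j where "j = (LEAST i. P i \<in> K)"
  have Pj: "P j \<in> K" unfolding j_def by (rule LeastI_ex[OF ex])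
  have "P 0 \<notin> K" using x by (simp add: P_def)
  with Pj obtain i where i: "j = Suc i" by (cases j) auto
  define z where "z = P i"
  have z: "z \<in> carrier G" "z \<notin> K" "z \<otimes> z \<in> K"
    using PG Pj P_Suc i not_less_Least[of i "\<lambda>i. P i \<in> K"] unfolding z_def j_def by auto
  have conj: "P i \<otimes> h \<otimes> inv P i \<in> K" if "h \<in> K" for h i
    using that
  proof (induction i arbitrary: h)
    case (Suc i)
    have hG: "h \<in> carrier G" using Suc K.subset by auto
    have "P (Suc i) \<otimes> h \<otimes> inv P (Suc i) = P i \<otimes> (P i \<otimes> h \<otimes> inv P i) \<otimes> inv P i"
      using PG hG by (simp add: P_Suc m_assoc inv_mult_group)
    then show ?case using Suc by simp
  qed (use xK x in \<open>simp add: P_def\<close>)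
  \<comment> \<open>The union of \<open>K\<close> and its coset by \<open>z\<close> is a subgroup,
    because \<open>z\<close> conjugates \<open>K\<close> into itself and squares into
    \<open>K\<close>. By maximality it is all of \<open>G\<close>.\<close>
  define W where "W = K \<union> (\<lambda>h. h \<otimes> z) ` K"
  have KG: "h \<in> carrier G" if "h \<in> K" for h using that K.subset by auto
  have zk: "z \<otimes> h = (z \<otimes> h \<otimes> inv z) \<otimes> z" if "h \<in> K" for h
    using z KG[OF that] by (simp add: m_assoc)
  have zK: "z \<otimes> h \<otimes> inv z \<in> K" if "h \<in> K" for h using conj that by (simp add: z_def)
  have W: "subgroup W G"
  proof (rule subgroupI)
    show "W \<subseteq> carrier G" "W \<noteq> {}" using z KG K.one_closed by (auto simp: W_def)
    show "inv w \<in> W" if "w \<in> W" for w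
      using that unfolding W_def
    proof (elim UnE imageE)
      fix h assume h: "w = h \<otimes> z" "h \<in> K"
      \<comment> \<open>Only conjugation by \<open>z\<close>, not by \<open>inv z\<close>, is known
        to preserve \<open>K\<close>, so \<open>inv z\<close> is rewritten as
        \<open>inv (z \<otimes> z) \<otimes> z\<close>.\<close>
      have "inv w = inv (z \<otimes> z) \<otimes> (z \<otimes> inv h \<otimes> inv z) \<otimes> z"
        using h z KG by (simp add: inv_mult_group m_assoc)
      moreover have "inv (z \<otimes> z) \<otimes> (z \<otimes> inv h \<otimes> inv z) \<in> K"
        using h z(3) zK K.m_closed K.m_inv_closed by blast
      ultimately show "inv w \<in> K \<union> (\<lambda>h. h \<otimes> z) ` K" by blast
    qed auto
    have a: "h \<otimes> z \<otimes> h' \<in> (\<lambda>h. h \<otimes> z) ` K" if "h \<in> K" "h' \<in> K" for h h'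
    proof -
      have "h \<otimes> z \<otimes> h' = (h \<otimes> (z \<otimes> h' \<otimes> inv z)) \<otimes> z"
        using that z KG by (simp add: m_assoc)
      then show ?thesis using that zK by blast
    qed
    have b: "h \<otimes> z \<otimes> (h' \<otimes> z) \<in> K" if "h \<in> K" "h' \<in> K" for h h'
    proof -
      have "h \<otimes> z \<otimes> (h' \<otimes> z) = (h \<otimes> (z \<otimes> h' \<otimes> inv z)) \<otimes> (z \<otimes> z)"
        using that z KG by (simp add: m_assoc)
      then show ?thesis using that zK z(3) by simp
    qed
    show "v \<otimes> w \<in> W" if "v \<in> W" "w \<in> W" for v w
    proof -
      have "v \<otimes> (h \<otimes> z) \<in> (\<lambda>h. h \<otimes> z) ` K" if "v \<in> K" "h \<in> K" for v h
        using that z(1) KG by (intro image_eqI[where x = "v \<otimes> h"]) (auto simp: m_assoc)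
      then show ?thesis using that a b unfolding W_def by (elim UnE imageE) auto
    qed
  qed
  have "z \<in> W" using K.one_closed z(1) unfolding W_def by (metis UnCI image_eqI l_one)
  then have "W = carrier G"
    using max[of W] W z(2) K by (auto simp: \<K>_def W_def)
  then have "y \<otimes> y \<in> K" if "y \<in> carrier G" for y
  proof -
    from that \<open>W = carrier G\<close> have "y \<in> W" by simp
    then show ?thesis unfolding W_def
    proof (elim UnE imageE)
      fix h assume h: "y = h \<otimes> z" "h \<in> K"
      have "y \<otimes> y = (h \<otimes> (z \<otimes> h \<otimes> inv z)) \<otimes> (z \<otimes> z)"
        using h z KG by (simp add: m_assoc)
      then show ?thesis using h zK z(3) by simp
    qed auto
  qed
  then show ?thesis using K by (auto simp: \<K>_def)
qed

text \<open>The Frattini argument for 2-groups: squares are non-generators, since a proper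
  \<open>H\<close> lies in a proper subgroup that contains them all.\<close>

lemma two_group_generate_squares:
  assumes "order G = 2 ^ k" and "subgroup H G"
    and sub: "\<And>K. subgroup K G \<Longrightarrow> H \<subseteq> K \<Longrightarrow> squares_generated G (carrier G) \<subseteq> K \<Longrightarrow> K = carrier G"
  shows "H = carrier G"
proof (rule ccontr)
  assume "H \<noteq> carrier G"
  then obtain K where K: "subgroup K G" "H \<subseteq> K" "K \<noteq> carrier G" "\<And>x. x \<in> carrier G \<Longrightarrow> x \<otimes> x \<in> K"
    using two_group_proper_subgroup_squares assms by blast
  then have "squares_generated G (carrier G) \<subseteq> K"
    unfolding squares_generated_def by (intro generate_subgroup_incl) auto
  then show False using sub K by blast
qed

end

section \<open>Groups of type (2,4) modulo the derived subgroup\<close>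

context group
begin

text \<open>Hides cosets behind an opaque group \<open>Q\<close> and map \<open>h\<close>, so that
  computations in the quotient do not unfold them.\<close>

lemma quotient_hom:
  assumes "N \<lhd> G"
  obtains Q :: "'a set monoid" and h where "group_hom G Q h" "h ` carrier G = carrier Q"
    "\<And>x. x \<in> carrier G \<Longrightarrow> h x = \<one>\<^bsub>Q\<^esub> \<longleftrightarrow> x \<in> N"
proof (rule that[of "G Mod N" "\<lambda>x. N #> x"])
  show "group_hom G (G Mod N) (\<lambda>x. N #> x)" using coset_hom[OF assms] .
  show "(\<lambda>x. N #> x) ` carrier G = carrier (G Mod N)" by (simp add: carrier_FactGroup)
  show "N #> x = \<one>\<^bsub>G Mod N\<^esub> \<longleftrightarrow> x \<in> N" if "x \<in> carrier G" for x
    using coset_eq_iff[OF normal_imp_subgroup[OF assms] that] by simp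
qed

lemma generate_pairwise_commute:
  assumes S: "S \<subseteq> carrier G" and comm: "\<And>s t. s \<in> S \<Longrightarrow> t \<in> S \<Longrightarrow> s \<otimes> t = t \<otimes> s"
    and x: "x \<in> generate G S" and y: "y \<in> generate G S"
  shows "x \<otimes> y = y \<otimes> x"
proof -
  have y_comm: "s \<otimes> y = y \<otimes> s" if s: "s \<in> S" for s
    using generate_commute[OF S _ comm[OF _ s] y] s S by auto
  show ?thesis
    by (rule generate_commute[OF S generate_in_carrier[OF S y] y_comm x])
qed

lemma mult_inv_telescope:
  assumes "x \<in> carrier G" "y \<in> carrier G" "z \<in> carrier G"
  shows "(x \<otimes> inv y) \<otimes> (y \<otimes> inv z) = x \<otimes> inv z"
  using assms by (simp add: m_assoc)

text \<open>Here \<open>c = [a, b]\<close>. When \<open>c\<close> commutes with \<open>a\<close>,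
  \<open>[a^2, b] = c^2\<close>, which is trivial.\<close>

lemma square_commutes_if_commutator_commutes:
  assumes car: "a \<in> carrier G" "b \<in> carrier G" "c \<in> carrier G"
    and c: "a \<otimes> b = c \<otimes> (b \<otimes> a)" "c \<otimes> c = \<one>" and ca: "c \<otimes> a = a \<otimes> c"
  shows "(a \<otimes> a) \<otimes> b = b \<otimes> (a \<otimes> a)"
proof -
  have "(a \<otimes> a) \<otimes> b = a \<otimes> (c \<otimes> (b \<otimes> a))" using car c(1) by (simp only: m_assoc)
  also have "\<dots> = (c \<otimes> a) \<otimes> (b \<otimes> a)" using car ca by (simp add: m_assoc)
  also have "\<dots> = c \<otimes> (a \<otimes> b) \<otimes> a" using car by (simp add: m_assoc)
  also have "\<dots> = (c \<otimes> c) \<otimes> (b \<otimes> (a \<otimes> a))" unfolding c(1) using car by (simp add: m_assoc)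
  finally show ?thesis using car c by simp
qed

text \<open>In general \<open>[a^2, b]\<close> is the conjugate of \<open>c\<close> by
  \<open>a\<close> times \<open>c\<close>. If this is trivial and \<open>c\<close> is its own
  inverse, then that conjugate is \<open>c\<close> itself.\<close>

lemma commutator_commutes_if_square_commutes:
  assumes car: "a \<in> carrier G" "b \<in> carrier G" "c \<in> carrier G"
    and c: "a \<otimes> b = c \<otimes> (b \<otimes> a)" "c \<otimes> c = \<one>" and aab: "(a \<otimes> a) \<otimes> b = b \<otimes> (a \<otimes> a)"
  shows "c \<otimes> a = a \<otimes> c"
proof -
  have "a \<otimes> (c \<otimes> (b \<otimes> a)) = (b \<otimes> a) \<otimes> a"
    using car aab by (simp add: m_assoc flip: c(1))
  then have "(a \<otimes> c \<otimes> b) \<otimes> a = (b \<otimes> a) \<otimes> a" using car by (simp add: m_assoc)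
  then have "a \<otimes> c \<otimes> b = b \<otimes> a" using car by (simp add: r_cancel)
  then have "c \<otimes> (a \<otimes> c \<otimes> b) = a \<otimes> b" using c(1) by simp
  then have "(c \<otimes> a \<otimes> c) \<otimes> b = a \<otimes> b" using car by (simp add: m_assoc)
  then have "c \<otimes> a \<otimes> c = a" using car by (simp add: r_cancel)
  then have "c \<otimes> a \<otimes> (c \<otimes> c) = a \<otimes> c" using car by (metis m_assoc m_closed)
  then show ?thesis using car c by simp
qed

end

section \<open>The lifts \<open>a\<close>, \<open>b\<close> and the quotient of \<open>G\<close> by
  \<open>R = [G', G]\<Phi>\<close>\<close>

locale two_group_type_2_4 = group G for G (structure) +
  fixes k :: nat and a b :: 'a and M :: "'a set"
  assumes order_eq: "order G = 2 ^ k"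
    and a_carrier: "a \<in> carrier G" and b_carrier: "b \<in> carrier G"
    and generate_ab: "generate G {a, b} = carrier G"
    and a2: "a \<otimes> a \<in> derived G (carrier G)"
    and b4: "(b \<otimes> b) \<otimes> (b \<otimes> b) \<in> derived G (carrier G)"
    and M_subset: "M \<subseteq> carrier G"
    and M_cosets: "\<And>x. x \<in> M \<Longrightarrow> \<exists>d\<in>derived G (carrier G).
      x \<in> {d, a \<otimes> d, (b \<otimes> b) \<otimes> d, a \<otimes> (b \<otimes> b) \<otimes> d}"
begin

abbreviation D where "D \<equiv> derived G (carrier G)"
abbreviation \<Phi> where "\<Phi> \<equiv> squares_generated G D"
abbreviation R where "R \<equiv> comm_ext G D \<Phi>"

definition c where "c = a \<otimes> b \<otimes> inv a \<otimes> inv b"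

lemma D_normal: "D \<lhd> G" by (rule derived_self_is_normal)
lemma \<Phi>_normal: "\<Phi> \<lhd> G" by (rule squares_generated_normal[OF D_normal])
lemma R_normal: "R \<lhd> G" by (rule comm_ext_normal[OF D_normal \<Phi>_normal])

lemma D_carrier: "d \<in> D \<Longrightarrow> d \<in> carrier G"
  using derived_in_carrier[of "carrier G"] by auto

lemma commutator_mem_D:
  "x \<in> carrier G \<Longrightarrow> y \<in> carrier G \<Longrightarrow> x \<otimes> y \<otimes> inv x \<otimes> inv y \<in> D"
  unfolding derived_def by (rule generate.incl) blast

text \<open>Modulo \<open>W\<close> the generators \<open>a\<close> and \<open>b\<close> commute, so
  the quotient is abelian. Thus \<open>D\<close> is the normal closure of the single commutator
  \<open>c\<close>.\<close>

lemma D_subset_if_normal: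
  assumes W: "W \<lhd> G" and c: "c \<in> W"
  shows "D \<subseteq> W"
proof -
  obtain Q :: "'a set monoid" and h where gh: "group_hom G Q h" and surj: "h ` carrier G = carrier Q"
    and ker: "\<And>x. x \<in> carrier G \<Longrightarrow> h x = \<one>\<^bsub>Q\<^esub> \<longleftrightarrow> x \<in> W"
    by (rule quotient_hom[OF W]) (rule that)
  interpret h: group_hom G Q h by (rule gh)
  have ab: "h a \<in> carrier Q" "h b \<in> carrier Q" using a_carrier b_carrier by auto
  have "h c = \<one>\<^bsub>Q\<^esub>" using ker[of c] c a_carrier b_carrier by (simp add: c_def)
  then have ab_comm: "h a \<otimes>\<^bsub>Q\<^esub> h b = h b \<otimes>\<^bsub>Q\<^esub> h a"
    using a_carrier b_carrier h.H.commutator_eq_one_iff[OF ab] by (simp add: c_def)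
  have gen: "h x \<in> generate Q {h a, h b}" if "x \<in> carrier G" for x
    using h.generate_img[of "{a, b}"] a_carrier b_carrier generate_ab that by auto
  have "x \<otimes> y \<otimes> inv x \<otimes> inv y \<in> W" if xy: "x \<in> carrier G" "y \<in> carrier G" for x y
  proof -
    have "h x \<otimes>\<^bsub>Q\<^esub> h y = h y \<otimes>\<^bsub>Q\<^esub> h x"
      by (rule h.H.generate_pairwise_commute[OF _ _ gen[OF xy(1)] gen[OF xy(2)]])
        (use ab ab_comm in auto)
    then have "h (x \<otimes> y \<otimes> inv x \<otimes> inv y) = \<one>\<^bsub>Q\<^esub>"
      using h.H.commutator_eq_one_iff[of "h x" "h y"] xy by simp
    then show ?thesis using ker[of "x \<otimes> y \<otimes> inv x \<otimes> inv y"] xy by blast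
  qed
  then show ?thesis
    unfolding derived_def by (intro generate_subgroup_incl normal_imp_subgroup[OF W]) blast
qed

text \<open>Used with \<open>L = D\<close> and with \<open>L = R\<close>: in the quotient by
  \<open>[L, G]\<Phi>\<close> the image of \<open>L\<close> is central and squares of elements of
  \<open>D\<close> vanish.\<close>

lemma quotient_comm_ext:
  assumes L: "L \<lhd> G"
  obtains Q :: "'a set monoid" and h where "group_hom G Q h"
    "\<And>x. x \<in> carrier G \<Longrightarrow> h x = \<one>\<^bsub>Q\<^esub> \<longleftrightarrow> x \<in> comm_ext G L \<Phi>"
    "\<And>x g. x \<in> L \<Longrightarrow> g \<in> carrier G \<Longrightarrow> h x \<otimes>\<^bsub>Q\<^esub> h g = h g \<otimes>\<^bsub>Q\<^esub> h x"
    "\<And>d. d \<in> D \<Longrightarrow> h d \<otimes>\<^bsub>Q\<^esub> h d = \<one>\<^bsub>Q\<^esub>"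
proof -
  obtain Q :: "'a set monoid" and h where gh: "group_hom G Q h"
    and ker: "\<And>x. x \<in> carrier G \<Longrightarrow> h x = \<one>\<^bsub>Q\<^esub> \<longleftrightarrow> x \<in> comm_ext G L \<Phi>"
    by (rule quotient_hom[OF comm_ext_normal[OF L \<Phi>_normal]]) (rule that)
  interpret h: group_hom G Q h by (rule gh)
  have L_carrier: "x \<in> carrier G" if "x \<in> L" for x
    using subgroup.mem_carrier[OF normal_imp_subgroup[OF L] that] .
  have cent: "h x \<otimes>\<^bsub>Q\<^esub> h g = h g \<otimes>\<^bsub>Q\<^esub> h x" if "x \<in> L" "g \<in> carrier G" for x g
  proof -
    have "h (x \<otimes> g \<otimes> inv x \<otimes> inv g) = \<one>\<^bsub>Q\<^esub>"
      using ker[of "x \<otimes> g \<otimes> inv x \<otimes> inv g"] commutator_mem_comm_ext[OF that] L_carrier that by simp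
    then show ?thesis
      using h.H.commutator_eq_one_iff[of "h x" "h g"] L_carrier that by simp
  qed
  have sq: "h d \<otimes>\<^bsub>Q\<^esub> h d = \<one>\<^bsub>Q\<^esub>" if d: "d \<in> D" for d
  proof -
    have "d \<otimes> d \<in> comm_ext G L \<Phi>"
      by (rule subsetD[OF subset_comm_ext square_mem_squares_generated[OF d]])
    then show ?thesis using ker[of "d \<otimes> d"] D_carrier[OF d] h.hom_mult by simp
  qed
  show thesis by (rule that[OF gh ker cent sq])
qed

text \<open>Modulo \<open>R\<close> the commutator \<open>c\<close> is central and squares to the
  identity, so it generates a normal subgroup of order at most 2, and this contains the image of
  \<open>D\<close>.\<close>

lemma D_mod_R:
  assumes d: "d \<in> D"
  shows "d \<in> R \<or> d \<otimes> inv c \<in> R"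
proof -
  obtain Q :: "'a set monoid" and h where gh: "group_hom G Q h"
    and ker: "\<And>x. x \<in> carrier G \<Longrightarrow> h x = \<one>\<^bsub>Q\<^esub> \<longleftrightarrow> x \<in> R"
    and cent: "\<And>x g. x \<in> D \<Longrightarrow> g \<in> carrier G \<Longrightarrow> h x \<otimes>\<^bsub>Q\<^esub> h g = h g \<otimes>\<^bsub>Q\<^esub> h x"
    and sq: "\<And>d. d \<in> D \<Longrightarrow> h d \<otimes>\<^bsub>Q\<^esub> h d = \<one>\<^bsub>Q\<^esub>"
    by (rule quotient_comm_ext[OF D_normal]) (rule that)
  interpret h: group_hom G Q h by (rule gh)
  have cD: "c \<in> D" using commutator_mem_D a_carrier b_carrier by (simp add: c_def)
  have cG: "c \<in> carrier G" using D_carrier[OF cD] .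
  \<comment> \<open>The preimage of the subgroup generated by \<open>h c\<close>, to which
    \<open>D_subset_if_normal\<close> will be applied.\<close>
  define W where "W = {x \<in> carrier G. h x = \<one>\<^bsub>Q\<^esub> \<or> h x = h c}"
  have inv_c: "inv\<^bsub>Q\<^esub> h c = h c"
    by (rule h.H.inv_equality) (use sq[OF cD] cG h.hom_closed in auto)
  have "W \<lhd> G"
  proof (rule normal_invI)
    show "subgroup W G"
    proof (rule subgroupI)
      show "inv w \<in> W" if "w \<in> W" for w
        using that inv_c by (auto simp: W_def)
      show "v \<otimes> w \<in> W" if "v \<in> W" "w \<in> W" for v w
        using that sq[OF cD] h.hom_closed[OF cG] h.H.r_one by (auto simp: W_def)
    qed (auto simp: W_def intro: exI[of _ \<one>])
    show "g \<otimes> w \<otimes> inv g \<in> W" if "w \<in> W" "g \<in> carrier G" for g w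
    proof -
      have wG: "w \<in> carrier G" using that by (simp add: W_def)
      have "h w \<otimes>\<^bsub>Q\<^esub> h g = h g \<otimes>\<^bsub>Q\<^esub> h w"
      proof -
        have "h w = \<one>\<^bsub>Q\<^esub> \<or> h w = h c" using that(1) by (simp add: W_def)
        then show ?thesis
        proof
          assume "h w = \<one>\<^bsub>Q\<^esub>"
          then show ?thesis using h.H.l_one h.H.r_one h.hom_closed[OF that(2)] by (simp only:)
        next
          assume "h w = h c"
          then show ?thesis using cent[OF cD that(2)] by (simp only:)
        qed
      qed
      then have "h (g \<otimes> w \<otimes> inv g) = h w"
        using that(2) wG h.H.m_assoc[of "h w" "h g" "inv\<^bsub>Q\<^esub> h g"]
        by (simp only: h.hom_mult h.hom_inv m_closed inv_closed h.hom_closed h.H.inv_closed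
            h.H.r_inv h.H.r_one)
      then show ?thesis using that by (simp add: W_def)
    qed
  qed
  moreover have "c \<in> W" using cG by (simp add: W_def)
  ultimately have "d \<in> W" using D_subset_if_normal d by blast
  then consider "h d = \<one>\<^bsub>Q\<^esub>" | "h d = h c" by (auto simp: W_def)
  then show ?thesis
  proof cases
    case 1
    then show ?thesis using ker D_carrier[OF d] by simp
  next
    case 2
    then have "h (d \<otimes> inv c) = \<one>\<^bsub>Q\<^esub>"
      using D_carrier[OF d] cG h.hom_mult[of d "inv c"] h.hom_inv[OF cG] h.hom_closed[OF cG] h.H.r_inv
      by (simp only: inv_closed)
    then show ?thesis using ker[of "d \<otimes> inv c"] D_carrier[OF d] cG by blast
  qed
qed

lemma c_carrier: "c \<in> carrier G"
  using a_carrier b_carrier by (simp add: c_def)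

lemma ab_eq: "a \<otimes> b = c \<otimes> (b \<otimes> a)"
  using a_carrier b_carrier by (simp add: c_def m_assoc)

text \<open>Modulo \<open>R\<close> the subgroup \<open>D\<close> is central and \<open>c\<close>
  squares to the identity, so \<open>b \<otimes> b\<close> commutes with \<open>a\<close>. The
  cosets covering \<open>M\<close> lie in the subgroup generated by \<open>a\<close>,
  \<open>b \<otimes> b\<close> and \<open>D\<close>, hence the image of \<open>M\<close> is
  commutative.\<close>

lemma M_mod_R:
  obtains Q :: "'a set monoid" and h where "group_hom G Q h"
    "\<And>x. x \<in> carrier G \<Longrightarrow> h x = \<one>\<^bsub>Q\<^esub> \<longleftrightarrow> x \<in> R"
    "\<And>x g. x \<in> D \<Longrightarrow> g \<in> carrier G \<Longrightarrow> h x \<otimes>\<^bsub>Q\<^esub> h g = h g \<otimes>\<^bsub>Q\<^esub> h x"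
    "\<And>d. d \<in> D \<Longrightarrow> h d \<otimes>\<^bsub>Q\<^esub> h d = \<one>\<^bsub>Q\<^esub>"
    "\<And>x y. x \<in> M \<Longrightarrow> y \<in> M \<Longrightarrow> h x \<otimes>\<^bsub>Q\<^esub> h y = h y \<otimes>\<^bsub>Q\<^esub> h x"
    "h a \<otimes>\<^bsub>Q\<^esub> h (b \<otimes> b) = h (b \<otimes> b) \<otimes>\<^bsub>Q\<^esub> h a"
proof -
  obtain Q :: "'a set monoid" and h where gh: "group_hom G Q h"
    and ker: "\<And>x. x \<in> carrier G \<Longrightarrow> h x = \<one>\<^bsub>Q\<^esub> \<longleftrightarrow> x \<in> R"
    and cent: "\<And>x g. x \<in> D \<Longrightarrow> g \<in> carrier G \<Longrightarrow> h x \<otimes>\<^bsub>Q\<^esub> h g = h g \<otimes>\<^bsub>Q\<^esub> h x"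
    and sq: "\<And>d. d \<in> D \<Longrightarrow> h d \<otimes>\<^bsub>Q\<^esub> h d = \<one>\<^bsub>Q\<^esub>"
    by (rule quotient_comm_ext[OF D_normal]) (rule that)
  interpret h: group_hom G Q h by (rule gh)
  have cD: "c \<in> D" using commutator_mem_D a_carrier b_carrier by (simp add: c_def)
  have cG: "h c \<in> carrier Q" and aG: "h a \<in> carrier Q" and bG: "h b \<in> carrier Q"
    using c_carrier a_carrier b_carrier h.hom_closed by blast+
  have "h a \<otimes>\<^bsub>Q\<^esub> h b = h (c \<otimes> (b \<otimes> a))"
    using ab_eq a_carrier b_carrier by (metis h.hom_mult)
  also have "\<dots> = h c \<otimes>\<^bsub>Q\<^esub> (h b \<otimes>\<^bsub>Q\<^esub> h a)"
    using c_carrier a_carrier b_carrier by (simp only: h.hom_mult m_closed)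
  finally have "h c \<otimes>\<^bsub>Q\<^esub> (h a \<otimes>\<^bsub>Q\<^esub> h b) = (h c \<otimes>\<^bsub>Q\<^esub> h c) \<otimes>\<^bsub>Q\<^esub> (h b \<otimes>\<^bsub>Q\<^esub> h a)"
    by (simp only: h.H.m_assoc cG aG bG h.H.m_closed)
  \<comment> \<open>Being its own inverse, \<open>h c\<close> is also the commutator of
    \<open>h b\<close> and \<open>h a\<close>; this lets the lemma on squares be used with
    \<open>a\<close> and \<open>b\<close> exchanged.\<close>
  then have ba: "h b \<otimes>\<^bsub>Q\<^esub> h a = h c \<otimes>\<^bsub>Q\<^esub> (h a \<otimes>\<^bsub>Q\<^esub> h b)"
    by (simp only: sq[OF cD] h.H.l_one aG bG h.H.m_closed)
  have "(h b \<otimes>\<^bsub>Q\<^esub> h b) \<otimes>\<^bsub>Q\<^esub> h a = h a \<otimes>\<^bsub>Q\<^esub> (h b \<otimes>\<^bsub>Q\<^esub> h b)"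
    by (rule h.H.square_commutes_if_commutator_commutes
        [OF bG aG cG ba sq[OF cD] cent[OF cD b_carrier]])
  then have abb: "h a \<otimes>\<^bsub>Q\<^esub> h (b \<otimes> b) = h (b \<otimes> b) \<otimes>\<^bsub>Q\<^esub> h a"
    unfolding h.hom_mult[OF b_carrier b_carrier] by (rule sym)
  define S where "S = {a, b \<otimes> b} \<union> D"
  have S: "S \<subseteq> carrier G" using a_carrier b_carrier D_carrier by (auto simp: S_def)
  have comm: "s \<otimes>\<^bsub>Q\<^esub> t = t \<otimes>\<^bsub>Q\<^esub> s" if "s \<in> h ` S" "t \<in> h ` S" for s t
  proof -
    obtain u v where uv: "u \<in> S" "v \<in> S" "s = h u" "t = h v" using \<open>s \<in> h ` S\<close> \<open>t \<in> h ` S\<close> by blast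
    show ?thesis
      unfolding uv(3,4)
    proof (cases "u \<in> D")
      case True
      then show "h u \<otimes>\<^bsub>Q\<^esub> h v = h v \<otimes>\<^bsub>Q\<^esub> h u" using cent uv(2) S by blast
    next
      case u: False
      show "h u \<otimes>\<^bsub>Q\<^esub> h v = h v \<otimes>\<^bsub>Q\<^esub> h u"
      proof (cases "v \<in> D")
        case True
        then show ?thesis using cent[of v u] uv(1) S by (metis subsetD)
      next
        case False
        then have "u = a \<or> u = b \<otimes> b" "v = a \<or> v = b \<otimes> b" using u uv(1,2) by (auto simp: S_def)
        then show ?thesis by (elim disjE) (simp_all only: abb)
      qed
    qed
  qed
  have gen: "h x \<in> generate Q (h ` S)" if xM: "x \<in> M" for x
  proof -
    obtain d where d: "d \<in> D" "x \<in> {d, a \<otimes> d, (b \<otimes> b) \<otimes> d, a \<otimes> (b \<otimes> b) \<otimes> d}"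
      using M_cosets[OF xM] by blast
    have gd: "d \<in> generate G S" and ga: "a \<in> generate G S" and gb: "b \<otimes> b \<in> generate G S"
      using d(1) by (auto simp: S_def intro: generate.incl)
    have "x \<in> generate G S"
      using d(2) gd generate.eng[OF ga gd] generate.eng[OF gb gd]
        generate.eng[OF generate.eng[OF ga gb] gd] by blast
    then show ?thesis using h.generate_img[OF S] by blast
  qed
  have hS: "h ` S \<subseteq> carrier Q" using S h.hom_closed by blast
  have M_comm: "h x \<otimes>\<^bsub>Q\<^esub> h y = h y \<otimes>\<^bsub>Q\<^esub> h x" if "x \<in> M" "y \<in> M" for x y
    by (rule h.H.generate_pairwise_commute[OF hS comm gen[OF that(1)] gen[OF that(2)]])
  show thesis by (rule that[OF gh ker cent sq M_comm abb])
qed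

lemma derived_M_subset_R: "derived G M \<subseteq> R"
proof -
  obtain Q :: "'a set monoid" and h where gh: "group_hom G Q h"
    and ker: "\<And>x. x \<in> carrier G \<Longrightarrow> h x = \<one>\<^bsub>Q\<^esub> \<longleftrightarrow> x \<in> R"
    and comm: "\<And>x y. x \<in> M \<Longrightarrow> y \<in> M \<Longrightarrow> h x \<otimes>\<^bsub>Q\<^esub> h y = h y \<otimes>\<^bsub>Q\<^esub> h x"
    by (rule M_mod_R) (rule that)
  interpret h: group_hom G Q h by (rule gh)
  have "x \<otimes> y \<otimes> inv x \<otimes> inv y \<in> R" if xy: "x \<in> M" "y \<in> M" for x y
  proof -
    have G: "x \<in> carrier G" "y \<in> carrier G" using xy M_subset by auto
    then have "h (x \<otimes> y \<otimes> inv x \<otimes> inv y) = \<one>\<^bsub>Q\<^esub>"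
      using h.H.commutator_eq_one_iff[of "h x" "h y"] comm[OF xy] by simp
    then show ?thesis using ker[of "x \<otimes> y \<otimes> inv x \<otimes> inv y"] G by blast
  qed
  then show ?thesis
    unfolding derived_def[of G M]
    by (intro generate_subgroup_incl normal_imp_subgroup[OF R_normal]) blast
qed

text \<open>If both candidates lie in \<open>R\<close>, the image of \<open>M\<close> modulo
  \<open>R\<close> consists of commuting elements of order at most 2, so the squares of
  \<open>M\<close>, and with them \<open>D\<close>, lie in \<open>R\<close>. Otherwise a candidate
  outside \<open>R\<close> agrees with \<open>c\<close> modulo \<open>R\<close>, because
  \<open>D\<close> has at most two classes there.\<close>

lemma D_mod_R_square:
  assumes DM: "D \<subseteq> squares_generated G M"
  obtains s where "s \<in> {a \<otimes> a, (b \<otimes> b) \<otimes> (b \<otimes> b)}" "s \<in> D"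
    "\<And>d. d \<in> D \<Longrightarrow> d \<in> R \<or> d \<otimes> inv s \<in> R"
proof (cases "a \<otimes> a \<in> R \<and> (b \<otimes> b) \<otimes> (b \<otimes> b) \<in> R")
  case True
  obtain Q :: "'a set monoid" and h where gh: "group_hom G Q h"
    and ker: "\<And>x. x \<in> carrier G \<Longrightarrow> h x = \<one>\<^bsub>Q\<^esub> \<longleftrightarrow> x \<in> R"
    and cent: "\<And>x g. x \<in> D \<Longrightarrow> g \<in> carrier G \<Longrightarrow> h x \<otimes>\<^bsub>Q\<^esub> h g = h g \<otimes>\<^bsub>Q\<^esub> h x"
    and sq: "\<And>d. d \<in> D \<Longrightarrow> h d \<otimes>\<^bsub>Q\<^esub> h d = \<one>\<^bsub>Q\<^esub>"
    and abb: "h a \<otimes>\<^bsub>Q\<^esub> h (b \<otimes> b) = h (b \<otimes> b) \<otimes>\<^bsub>Q\<^esub> h a"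
    by (rule M_mod_R) (rule that)
  interpret h: group_hom G Q h by (rule gh)
  have bb: "b \<otimes> b \<in> carrier G" using b_carrier by simp
  have ha: "h a \<otimes>\<^bsub>Q\<^esub> h a = \<one>\<^bsub>Q\<^esub>" "h (b \<otimes> b) \<otimes>\<^bsub>Q\<^esub> h (b \<otimes> b) = \<one>\<^bsub>Q\<^esub>"
    using True ker[of "a \<otimes> a"] ker[of "(b \<otimes> b) \<otimes> (b \<otimes> b)"] a_carrier bb
    by (simp_all only: h.hom_mult m_closed)
  have prod: "h (y \<otimes> z) \<otimes>\<^bsub>Q\<^esub> h (y \<otimes> z) = \<one>\<^bsub>Q\<^esub>"
    if "y \<in> carrier G" "z \<in> carrier G" "h y \<otimes>\<^bsub>Q\<^esub> h z = h z \<otimes>\<^bsub>Q\<^esub> h y"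
      "h y \<otimes>\<^bsub>Q\<^esub> h y = \<one>\<^bsub>Q\<^esub>" "h z \<otimes>\<^bsub>Q\<^esub> h z = \<one>\<^bsub>Q\<^esub>" for y z
  proof -
    have "h (y \<otimes> z) \<otimes>\<^bsub>Q\<^esub> h (y \<otimes> z) = h y \<otimes>\<^bsub>Q\<^esub> (h z \<otimes>\<^bsub>Q\<^esub> h y) \<otimes>\<^bsub>Q\<^esub> h z"
      using that(1,2) by (simp add: h.H.m_assoc)
    also have "\<dots> = (h y \<otimes>\<^bsub>Q\<^esub> h y) \<otimes>\<^bsub>Q\<^esub> (h z \<otimes>\<^bsub>Q\<^esub> h z)"
      unfolding that(3)[symmetric] using that(1,2) by (simp add: h.H.m_assoc)
    finally show ?thesis by (simp only: that(4,5) h.H.l_one h.H.one_closed)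
  qed
  have "x \<otimes> x \<in> R" if xM: "x \<in> M" for x
  proof -
    obtain d where d: "d \<in> D" "x \<in> {d, a \<otimes> d, (b \<otimes> b) \<otimes> d, a \<otimes> (b \<otimes> b) \<otimes> d}"
      using M_cosets[OF xM] by blast
    have dG: "d \<in> carrier G" by (rule D_carrier[OF d(1)])
    have abG: "a \<otimes> (b \<otimes> b) \<in> carrier G" using a_carrier bb by simp
    have xG: "x \<in> carrier G" using xM M_subset by auto
    note sqd = sq[OF d(1)] and cd = cent[OF d(1), symmetric]
    have "h x \<otimes>\<^bsub>Q\<^esub> h x = \<one>\<^bsub>Q\<^esub>"
      using d(2) sqd prod[OF a_carrier dG cd[OF a_carrier] ha(1) sqd] prod[OF bb dG cd[OF bb] ha(2) sqd]
        prod[OF abG dG cd[OF abG] prod[OF a_carrier bb abb ha] sqd] by blast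
    then have "h (x \<otimes> x) = \<one>\<^bsub>Q\<^esub>" using xG by (simp only: h.hom_mult)
    then show ?thesis using ker[of "x \<otimes> x"] xG by blast
  qed
  then have "squares_generated G M \<subseteq> R"
    unfolding squares_generated_def[of G M]
    by (intro generate_subgroup_incl normal_imp_subgroup[OF R_normal]) blast
  \<comment> \<open>Now \<open>D \<subseteq> R\<close>, so the first alternative holds for every
    \<open>d\<close> and the choice of \<open>a \<otimes> a\<close> is arbitrary.\<close>
  then show thesis using that[of "a \<otimes> a"] a2 DM by blast
next
  case False
  then obtain s where s: "s \<in> {a \<otimes> a, (b \<otimes> b) \<otimes> (b \<otimes> b)}" "s \<notin> R" by blast
  have sD: "s \<in> D" using s(1) a2 b4 by auto
  have sG: "s \<in> carrier G" using D_carrier[OF sD] .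
  have R: "subgroup R G" using normal_imp_subgroup[OF R_normal] .
  have "inv (s \<otimes> inv c) \<in> R" using D_mod_R[OF sD] s(2) subgroup.m_inv_closed[OF R] by blast
  then have cs: "c \<otimes> inv s \<in> R"
    unfolding inv_mult_group[OF sG inv_closed[OF c_carrier]] inv_inv[OF c_carrier] .
  have "d \<in> R \<or> d \<otimes> inv s \<in> R" if d: "d \<in> D" for d
  proof (cases "d \<in> R")
    case False
    then have "(d \<otimes> inv c) \<otimes> (c \<otimes> inv s) \<in> R" using D_mod_R[OF d] cs subgroup.m_closed[OF R] by blast
    also have "(d \<otimes> inv c) \<otimes> (c \<otimes> inv s) = d \<otimes> inv s"
      by (rule mult_inv_telescope[OF D_carrier[OF d] c_carrier sG])
    finally show ?thesis by simp
  qed simp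
  then show thesis using that s(1) sD by blast
qed

end

section \<open>Cyclicity of the derived subgroup\<close>

context two_group_type_2_4
begin

lemma D_group: "group (G\<lparr>carrier := D\<rparr>)"
  by (rule subgroup_imp_group[OF normal_imp_subgroup[OF D_normal]])

lemma order_D: "\<exists>i. order (G\<lparr>carrier := D\<rparr>) = 2 ^ i"
  using card_subgroup_p_group[OF two_is_prime_nat order_eq normal_imp_subgroup[OF D_normal]]
  by (simp add: order_def)

text \<open>The Frattini argument inside the 2-group \<open>D\<close>, transferred to subgroups of
  \<open>G\<close>.\<close>

lemma eq_D_if_squares_generate:
  assumes H: "subgroup H G" "H \<subseteq> D"
    and gen: "\<And>K. subgroup K G \<Longrightarrow> H \<subseteq> K \<Longrightarrow> \<Phi> \<subseteq> K \<Longrightarrow> D \<subseteq> K"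
  shows "H = D"
proof -
  have D: "subgroup D G" using normal_imp_subgroup[OF D_normal] .
  interpret D: group "G\<lparr>carrier := D\<rparr>" by (rule D_group)
  obtain i where i: "order (G\<lparr>carrier := D\<rparr>) = 2 ^ i" using order_D by blast
  have "H = carrier (G\<lparr>carrier := D\<rparr>)"
  proof (rule D.two_group_generate_squares[OF i])
    show "subgroup H (G\<lparr>carrier := D\<rparr>)" using subgroup_incl[OF H(1) D H(2)] .
    fix K assume K: "subgroup K (G\<lparr>carrier := D\<rparr>)" "H \<subseteq> K"
      "squares_generated (G\<lparr>carrier := D\<rparr>) (carrier (G\<lparr>carrier := D\<rparr>)) \<subseteq> K"
    have "\<Phi> \<subseteq> K" using K(3) squares_generated_consistent[OF D] by simp
    moreover have "subgroup K G" using incl_subgroup[OF D K(1)] .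
    ultimately have "D \<subseteq> K" using gen K(2) by blast
    then show "K = carrier (G\<lparr>carrier := D\<rparr>)" using subgroup.subset[OF K(1)] by auto
  qed
  then show ?thesis by simp
qed

text \<open>If \<open>\<Phi>\<close> were all of \<open>D\<close>, the trivial subgroup together
  with the non-generators in \<open>\<Phi>\<close> would generate \<open>D\<close>.\<close>

lemma \<Phi>_neq_D:
  assumes "D \<noteq> {\<one>}"
  shows "\<Phi> \<noteq> D"
proof
  assume "\<Phi> = D"
  then have "{\<one>} = D"
    by (intro eq_D_if_squares_generate) (auto simp: triv_subgroup subgroup.one_closed normal_imp_subgroup D_normal)
  then show False using assms by simp
qed

context
  fixes s
  assumes s: "s \<in> {a \<otimes> a, (b \<otimes> b) \<otimes> (b \<otimes> b)}" "s \<in> D"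
    and D_mod: "\<And>d. d \<in> D \<Longrightarrow> d \<in> R \<or> d \<otimes> inv s \<in> R"
begin

text \<open>Modulo \<open>[R, G]\<Phi>\<close> the subgroup \<open>R\<close> is central, so
  commutation relations of elements of \<open>D\<close> depend only on their classes modulo
  \<open>R\<close>. As \<open>c\<close> agrees with a power of \<open>s\<close> there, it commutes
  with whichever of \<open>a\<close>, \<open>b\<close> has \<open>s\<close> as a power; the lemmas
  on squares supply the other one. Then \<open>c\<close> is central, hence so is \<open>D\<close>,
  that is, \<open>[D, G]\<Phi> \<subseteq> [R, G]\<Phi>\<close>.\<close>

lemma R_subset_next: "R \<subseteq> comm_ext G R \<Phi>"
proof -
  obtain Q :: "'a set monoid" and h where gh: "group_hom G Q h"
    and ker: "\<And>x. x \<in> carrier G \<Longrightarrow> h x = \<one>\<^bsub>Q\<^esub> \<longleftrightarrow> x \<in> comm_ext G R \<Phi>"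
    and cent: "\<And>x g. x \<in> R \<Longrightarrow> g \<in> carrier G \<Longrightarrow> h x \<otimes>\<^bsub>Q\<^esub> h g = h g \<otimes>\<^bsub>Q\<^esub> h x"
    and sq: "\<And>d. d \<in> D \<Longrightarrow> h d \<otimes>\<^bsub>Q\<^esub> h d = \<one>\<^bsub>Q\<^esub>"
    by (rule quotient_comm_ext[OF R_normal]) (rule that)
  interpret h: group_hom G Q h by (rule gh)
  have cD: "c \<in> D" using commutator_mem_D a_carrier b_carrier by (simp add: c_def)
  have cQ: "h c \<in> carrier Q" and aQ: "h a \<in> carrier Q" and bQ: "h b \<in> carrier Q"
    using c_carrier a_carrier b_carrier h.hom_closed by blast+
  have sG: "s \<in> carrier G" by (rule D_carrier[OF s(2)])
  \<comment> \<open>Multiplying by an element of \<open>R\<close>, central in \<open>Q\<close>, does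
    not change what an element commutes with.\<close>
  have transfer: "h x \<otimes>\<^bsub>Q\<^esub> h g = h g \<otimes>\<^bsub>Q\<^esub> h x"
    if x: "x \<in> carrier G" and y: "y \<in> carrier G" and xy: "x \<in> R \<or> x \<otimes> inv y \<in> R"
      and g: "g \<in> carrier G" and yg: "h y \<otimes>\<^bsub>Q\<^esub> h g = h g \<otimes>\<^bsub>Q\<^esub> h y" for x y g
    using xy
  proof
    assume "x \<in> R"
    then show ?thesis using cent g by blast
  next
    assume r: "x \<otimes> inv y \<in> R"
    let ?r = "x \<otimes> inv y"
    have rG: "?r \<in> carrier G" using x y by simp
    have "h x = h (?r \<otimes> y)" using x y by (simp add: m_assoc)
    then have hx: "h x = h ?r \<otimes>\<^bsub>Q\<^esub> h y" using h.hom_mult[OF rG y] by simp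
    have Q: "h ?r \<in> carrier Q" "h y \<in> carrier Q" "h g \<in> carrier Q" using rG y g h.hom_closed by blast+
    have "h x \<otimes>\<^bsub>Q\<^esub> h g = h ?r \<otimes>\<^bsub>Q\<^esub> (h g \<otimes>\<^bsub>Q\<^esub> h y)"
      unfolding hx by (simp only: h.H.m_assoc Q yg)
    also have "\<dots> = (h g \<otimes>\<^bsub>Q\<^esub> h ?r) \<otimes>\<^bsub>Q\<^esub> h y"
      by (simp only: h.H.m_assoc[symmetric] Q cent[OF r g])
    also have "\<dots> = h g \<otimes>\<^bsub>Q\<^esub> h x" unfolding hx by (simp only: h.H.m_assoc Q)
    finally show ?thesis .
  qed
  have ab: "h a \<otimes>\<^bsub>Q\<^esub> h b = h c \<otimes>\<^bsub>Q\<^esub> (h b \<otimes>\<^bsub>Q\<^esub> h a)"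
  proof -
    have "h a \<otimes>\<^bsub>Q\<^esub> h b = h (a \<otimes> b)" using a_carrier b_carrier by simp
    then show ?thesis unfolding ab_eq using a_carrier b_carrier c_carrier by simp
  qed
  have aaG: "a \<otimes> a \<in> carrier G" and bbG: "b \<otimes> b \<in> carrier G"
    and b4G: "(b \<otimes> b) \<otimes> (b \<otimes> b) \<in> carrier G"
    using a_carrier b_carrier by simp_all
  have c_comm: "h c \<otimes>\<^bsub>Q\<^esub> h a = h a \<otimes>\<^bsub>Q\<^esub> h c \<and> h c \<otimes>\<^bsub>Q\<^esub> h b = h b \<otimes>\<^bsub>Q\<^esub> h c"
  proof -
    consider "s = a \<otimes> a" | "s = (b \<otimes> b) \<otimes> (b \<otimes> b)" using s(1) by blast
    then show ?thesis
    proof cases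
      case 1
      have "h s \<otimes>\<^bsub>Q\<^esub> h a = h a \<otimes>\<^bsub>Q\<^esub> h s"
        unfolding 1 using a_carrier by (simp add: h.H.m_assoc)
      then have ca: "h c \<otimes>\<^bsub>Q\<^esub> h a = h a \<otimes>\<^bsub>Q\<^esub> h c"
        by (rule transfer[OF c_carrier sG D_mod[OF cD] a_carrier])
      \<comment> \<open>As \<open>c\<close> commutes with \<open>a\<close>, the square
        \<open>s\<close> of \<open>a\<close> commutes with \<open>b\<close>; this passes back to
        \<open>c\<close>.\<close>
      have "h s \<otimes>\<^bsub>Q\<^esub> h b = h b \<otimes>\<^bsub>Q\<^esub> h s"
        using h.H.square_commutes_if_commutator_commutes[OF aQ bQ cQ ab sq[OF cD] ca]
        by (simp only: 1 h.hom_mult a_carrier)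
      then have "h c \<otimes>\<^bsub>Q\<^esub> h b = h b \<otimes>\<^bsub>Q\<^esub> h c"
        by (rule transfer[OF c_carrier sG D_mod[OF cD] b_carrier])
      with ca show ?thesis ..
    next
      case 2
      have "h s \<otimes>\<^bsub>Q\<^esub> h b = h b \<otimes>\<^bsub>Q\<^esub> h s"
        unfolding 2 using b_carrier by (simp add: h.H.m_assoc)
      then have cb: "h c \<otimes>\<^bsub>Q\<^esub> h b = h b \<otimes>\<^bsub>Q\<^esub> h c"
        by (rule transfer[OF c_carrier sG D_mod[OF cD] b_carrier])
      \<comment> \<open>In this case \<open>a \<otimes> a\<close> need not be \<open>s\<close>, but
        as an element of \<open>D\<close> it is trivial or equal to \<open>c\<close> modulo
        \<open>R\<close>, so it commutes with \<open>b\<close> since \<open>c\<close> does.\<close>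
      have "h (a \<otimes> a) \<otimes>\<^bsub>Q\<^esub> h b = h b \<otimes>\<^bsub>Q\<^esub> h (a \<otimes> a)"
        by (rule transfer[OF aaG c_carrier D_mod_R[OF a2] b_carrier cb])
      then have "(h a \<otimes>\<^bsub>Q\<^esub> h a) \<otimes>\<^bsub>Q\<^esub> h b = h b \<otimes>\<^bsub>Q\<^esub> (h a \<otimes>\<^bsub>Q\<^esub> h a)"
        unfolding h.hom_mult[OF a_carrier a_carrier] .
      then have "h c \<otimes>\<^bsub>Q\<^esub> h a = h a \<otimes>\<^bsub>Q\<^esub> h c"
        by (rule h.H.commutator_commutes_if_square_commutes[OF aQ bQ cQ ab sq[OF cD]])
      with cb show ?thesis by blast
    qed
  qed
  have c_cent: "h c \<otimes>\<^bsub>Q\<^esub> h g = h g \<otimes>\<^bsub>Q\<^esub> h c" if g: "g \<in> carrier G" for g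
  proof -
    have "h g \<in> generate Q {h a, h b}"
      using h.generate_img[of "{a, b}"] a_carrier b_carrier generate_ab g by auto
    moreover have "t \<otimes>\<^bsub>Q\<^esub> h c = h c \<otimes>\<^bsub>Q\<^esub> t" if "t \<in> {h a, h b}" for t
      using that c_comm by auto
    ultimately show ?thesis using h.H.generate_commute[of "{h a, h b}" "h c" "h g"] aQ bQ cQ by simp
  qed
  have D_cent: "x \<otimes> g \<otimes> inv x \<otimes> inv g \<in> comm_ext G R \<Phi>" if x: "x \<in> D" and g: "g \<in> carrier G" for x g
  proof -
    have xG: "x \<in> carrier G" by (rule D_carrier[OF x])
    have "h x \<otimes>\<^bsub>Q\<^esub> h g = h g \<otimes>\<^bsub>Q\<^esub> h x"
      by (rule transfer[OF xG c_carrier D_mod_R[OF x] g c_cent[OF g]])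
    then have "h (x \<otimes> g \<otimes> inv x \<otimes> inv g) = \<one>\<^bsub>Q\<^esub>"
      using h.H.commutator_eq_one_iff[of "h x" "h g"] xG g by simp
    then show ?thesis using ker[of "x \<otimes> g \<otimes> inv x \<otimes> inv g"] xG g by blast
  qed
  show ?thesis
    by (rule comm_ext_subset[OF normal_imp_subgroup[OF comm_ext_normal[OF R_normal \<Phi>_normal]]
          subset_comm_ext D_cent])
qed

text \<open>Nilpotency, with \<open>L = R\<close> and \<open>N = \<Phi>\<close>.\<close>

lemma R_subset_\<Phi>: "R \<subseteq> \<Phi>"
  by (rule p_group_subset_comm_ext[OF two_is_prime_nat order_eq R_normal \<Phi>_normal R_subset_next])

text \<open>As \<open>R \<subseteq> \<Phi>\<close>, the element \<open>s\<close> generates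
  \<open>D\<close> modulo its Frattini subgroup, hence \<open>D\<close> itself.\<close>

lemma D_eq_generate: "generate G {s} = D"
proof (rule eq_D_if_squares_generate)
  have sG: "s \<in> carrier G" by (rule D_carrier[OF s(2)])
  show "subgroup (generate G {s}) G" using generate_is_subgroup sG by simp
  show "generate G {s} \<subseteq> D"
    using generate_subgroup_incl[of "{s}" D] s(2) normal_imp_subgroup[OF D_normal] by simp
  fix K assume K: "subgroup K G" "generate G {s} \<subseteq> K" "\<Phi> \<subseteq> K"
  have sK: "s \<in> K" using K(2) generate.incl[of s "{s}" G] by blast
  show "D \<subseteq> K"
  proof
    fix d assume d: "d \<in> D"
    have dG: "d \<in> carrier G" by (rule D_carrier[OF d])
    from D_mod[OF d] show "d \<in> K"
    proof
      assume "d \<otimes> inv s \<in> R"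
      then have "d \<otimes> inv s \<in> K" using R_subset_\<Phi> K(3) by blast
      then have "d \<otimes> inv s \<otimes> s \<in> K" using sK subgroup.m_closed[OF K(1)] by blast
      then show ?thesis using dG sG by (simp add: m_assoc)
    qed (use R_subset_\<Phi> K(3) in blast)
  qed
qed

end

lemma derived_cyclic:
  assumes DM: "D \<subseteq> squares_generated G M"
  shows "\<exists>s\<in>{a \<otimes> a, (b \<otimes> b) \<otimes> (b \<otimes> b)}. generate G {s} = D"
    and "derived G M \<subseteq> \<Phi>"
proof -
  obtain s where s: "s \<in> {a \<otimes> a, (b \<otimes> b) \<otimes> (b \<otimes> b)}" "s \<in> D"
    "\<And>d. d \<in> D \<Longrightarrow> d \<in> R \<or> d \<otimes> inv s \<in> R"
    by (rule D_mod_R_square[OF DM]) (rule that)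
  show "\<exists>s\<in>{a \<otimes> a, (b \<otimes> b) \<otimes> (b \<otimes> b)}. generate G {s} = D"
    using s(1) D_eq_generate[OF s] by blast
  show "derived G M \<subseteq> \<Phi>" using derived_M_subset_R R_subset_\<Phi>[OF s] by blast
qed

end

section \<open>Abelian groups of rank two, cyclic and metacyclic groups\<close>

text \<open>Trades the isomorphism for two generators, natural exponents and a divisibility test for
  relations, so that later arguments never touch the product group.\<close>

lemma of_type_pairE:
  assumes A: "of_type A [p, q]" and p: "p > 1" and q: "q > 1"
  obtains x y where "x \<in> carrier A" "y \<in> carrier A"
    "\<And>z. z \<in> carrier A \<Longrightarrow> \<exists>i j. z = x [^]\<^bsub>A\<^esub> (i::nat) \<otimes>\<^bsub>A\<^esub> y [^]\<^bsub>A\<^esub> (j::nat)"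
    "\<And>i j. x [^]\<^bsub>A\<^esub> (i::nat) \<otimes>\<^bsub>A\<^esub> y [^]\<^bsub>A\<^esub> (j::nat) = \<one>\<^bsub>A\<^esub> \<longleftrightarrow> p dvd i \<and> q dvd j"
    "order A = p * q"
proof -
  define P where "P = product_group {..<length [p, q]} (\<lambda>i. integer_mod_group ([p, q] ! i))"
  have gP: "group P" unfolding P_def by (rule product_group) simp
  interpret A: comm_group A using A by (simp add: of_type_def)
  have "A \<cong> P" using A by (simp add: of_type_def P_def)
  then have "P \<cong> A" by (rule A.iso_sym)
  then obtain \<psi> where \<psi>: "\<psi> \<in> iso P A" by (auto simp: is_iso_def)
  interpret \<psi>: group_hom P A \<psi>
    using \<psi> gP by (simp add: group_hom_def group_hom_axioms_def iso_def A.is_group)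
  have bij: "bij_betw \<psi> (carrier P) (carrier A)" using \<psi> by (simp add: iso_def)
  \<comment> \<open>The pair of residues of \<open>i\<close> and \<open>j\<close>; the restricted
    lambda makes it extensional, as elements of the product are.\<close>
  define E where "E i j = (\<lambda>t\<in>{..<length [p, q]}. if t = 0 then int i mod int p else int j mod int q)"
    for i j :: nat
  have lt2: "t < Suc (Suc 0) \<longleftrightarrow> t = 0 \<or> t = Suc 0" for t by auto
  have E_mem: "E i j \<in> carrier P" for i j
    using p q by (auto simp: P_def E_def carrier_integer_mod_group lt2)
  have E_mult: "E i j \<otimes>\<^bsub>P\<^esub> E i' j' = E (i + i') (j + j')" for i j i' j'
    by (auto simp: P_def E_def lt2 restrict_def fun_eq_iff mod_add_eq)
  have E_one: "E 0 0 = \<one>\<^bsub>P\<^esub>"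
    by (auto simp: P_def E_def lt2 restrict_def fun_eq_iff)
  have E_surj: "\<exists>i j. f = E i j" if f: "f \<in> carrier P" for f
  proof (intro exI)
    have f01: "f 0 \<in> {0..<int p}" "f (Suc 0) \<in> {0..<int q}"
      using p q PiE_mem[OF f[unfolded P_def carrier_product_group], of 0]
        PiE_mem[OF f[unfolded P_def carrier_product_group], of "Suc 0"]
      by (simp_all add: carrier_integer_mod_group)
    have ext: "f \<in> extensional {..<length [p, q]}" using f by (auto simp: P_def PiE_iff)
    show "f = E (nat (f 0)) (nat (f (Suc 0)))"
      by (rule extensionalityI[OF ext]) (use f01 in \<open>auto simp: E_def lt2\<close>)
  qed
  define x where "x = \<psi> (E 1 0)"
  define y where "y = \<psi> (E 0 1)"
  have xy: "x \<in> carrier A" "y \<in> carrier A" using E_mem by (simp_all add: x_def y_def)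
  have xi: "x [^]\<^bsub>A\<^esub> i = \<psi> (E i 0)" for i
  proof (induction i)
    case (Suc i)
    then show ?case using \<psi>.hom_mult[OF E_mem[of i 0] E_mem[of 1 0]] E_mult[of i 0 1 0]
      by (simp add: x_def)
  qed (simp add: E_one)
  have yj: "y [^]\<^bsub>A\<^esub> j = \<psi> (E 0 j)" for j
  proof (induction j)
    case (Suc j)
    then show ?case using \<psi>.hom_mult[OF E_mem[of 0 j] E_mem[of 0 1]] E_mult[of 0 j 0 1]
      by (simp add: y_def)
  qed (simp add: E_one)
  have xy_pow: "x [^]\<^bsub>A\<^esub> i \<otimes>\<^bsub>A\<^esub> y [^]\<^bsub>A\<^esub> j = \<psi> (E i j)" for i j
    using \<psi>.hom_mult[OF E_mem[of i 0] E_mem[of 0 j]] E_mult[of i 0 0 j] by (simp add: xi yj)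
  have "order A = card (carrier P)" using bij by (simp add: order_def bij_betw_same_card)
  also have "\<dots> = p * q"
    using p q by (simp add: P_def card_PiE carrier_integer_mod_group lessThan_Suc)
  finally have ord: "order A = p * q" .
  have surj: "\<exists>i j. z = x [^]\<^bsub>A\<^esub> (i::nat) \<otimes>\<^bsub>A\<^esub> y [^]\<^bsub>A\<^esub> (j::nat)" if z: "z \<in> carrier A" for z
  proof -
    obtain f where "f \<in> carrier P" "z = \<psi> f" using bij z by (auto simp: bij_betw_def)
    then show ?thesis using E_surj[of f] xy_pow by metis
  qed
  have inj: "x [^]\<^bsub>A\<^esub> i \<otimes>\<^bsub>A\<^esub> y [^]\<^bsub>A\<^esub> j = \<one>\<^bsub>A\<^esub> \<longleftrightarrow> p dvd i \<and> q dvd j" for i j :: nat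
  proof -
    have "x [^]\<^bsub>A\<^esub> i \<otimes>\<^bsub>A\<^esub> y [^]\<^bsub>A\<^esub> j = \<one>\<^bsub>A\<^esub> \<longleftrightarrow> \<psi> (E i j) = \<psi> (E 0 0)"
      unfolding xy_pow by (simp add: E_one)
    also have "\<dots> \<longleftrightarrow> E i j = E 0 0"
      using bij E_mem by (auto simp: bij_betw_def dest: inj_onD)
    also have "\<dots> \<longleftrightarrow> p dvd i \<and> q dvd j"
    proof
      assume eq: "E i j = E 0 0"
      have "int i mod int p = 0" using fun_cong[OF eq, of 0] by (simp add: E_def)
      moreover have "int j mod int q = 0" using fun_cong[OF eq, of "Suc 0"] by (simp add: E_def)
      ultimately show "p dvd i \<and> q dvd j" by (metis int_dvd_int_iff mod_0_imp_dvd)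
    next
      assume "p dvd i \<and> q dvd j"
      then have "int i mod int p = 0" "int j mod int q = 0" by simp_all
      then show "E i j = E 0 0" unfolding E_def by (intro restrict_ext) auto
    qed
    finally show ?thesis .
  qed
  show thesis by (rule that[OF xy surj inj ord])
qed

text \<open>The group is the internal direct product of \<open>{\<one>, w}\<close> and
  \<open>generate G {u}\<close>: together they generate it, and they meet trivially because
  \<open>w\<close> has order 2 and lies outside the second.\<close>

lemma (in comm_group) of_type_pairI:
  assumes fin: "finite (carrier G)" and w: "w \<in> carrier G" and u: "u \<in> carrier G"
    and ww: "w \<otimes> w = \<one>" and wu: "w \<notin> generate G {u}"
    and gen: "\<And>z. z \<in> carrier G \<Longrightarrow> \<exists>(i::int) (j::int). z = w [^] i \<otimes> u [^] j"
  shows "of_type G [2, ord u]"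
proof -
  define P where "P = product_group {..<length [2, ord u]} (\<lambda>i. integer_mod_group ([2, ord u] ! i))"
  have gP: "group P" unfolding P_def by (rule product_group) simp
  have ordu: "ord u > 0" using ord_ge_1[OF fin u] by simp
  have lt2: "t < Suc (Suc 0) \<longleftrightarrow> t = 0 \<or> t = Suc 0" for t by auto
  have "w \<noteq> \<one>" using wu generate.one[of G "{u}"] by blast
  have "w [^] (2::nat) = \<one>" using ww w by (simp add: numeral_2_eq_2)
  then have "ord w dvd 2" using pow_eq_id[OF w, of 2] by simp
  moreover have "ord w \<noteq> 1" using \<open>w \<noteq> \<one>\<close> ord_eq_1[OF w] by simp
  ultimately have ordw: "ord w = 2" using two_is_prime_nat unfolding prime_nat_iff by blast
  define \<psi> where "\<psi> f = w [^] (f 0 :: int) \<otimes> u [^] (f (Suc 0) :: int)" for f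
  have wmod: "w [^] (i mod 2) = w [^] i" for i :: int
    by (rule iffD2[OF int_pow_eq[OF w]]) (simp add: ordw minus_mod_eq_mult_div)
  have umod: "u [^] (i mod int (ord u)) = u [^] i" for i :: int
    by (rule iffD2[OF int_pow_eq[OF u]]) (simp add: minus_mod_eq_mult_div)
  have hom: "\<psi> \<in> hom P G"
  proof (rule homI)
    show "\<psi> f \<in> carrier G" for f using w u by (simp add: \<psi>_def)
    show "\<psi> (f \<otimes>\<^bsub>P\<^esub> g) = \<psi> f \<otimes> \<psi> g" for f g
    proof -
      have "\<psi> (f \<otimes>\<^bsub>P\<^esub> g) = w [^] (f 0 + g 0) \<otimes> u [^] (f (Suc 0) + g (Suc 0))"
        by (simp add: \<psi>_def P_def wmod umod)
      then show ?thesis unfolding \<psi>_def int_pow_mult[OF w] int_pow_mult[OF u]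
        using w u by (simp add: m_ac)
    qed
  qed
  interpret \<psi>: group_hom P G \<psi>
    by (intro group_hom.intro group_hom_axioms.intro gP is_group hom)
  have "\<psi> \<in> iso P G"
  proof (rule iffD2[OF \<psi>.iso_iff], intro conjI ballI impI subsetI)
    fix z assume "z \<in> carrier G"
    from gen[OF this] obtain i j :: int where z: "z = w [^] i \<otimes> u [^] j" by blast
    define f where "f = (\<lambda>t\<in>{..<length [2, ord u]}. if t = 0 then i mod 2 else j mod int (ord u))"
    have "f \<in> carrier P" using ordu by (auto simp: P_def f_def carrier_integer_mod_group lt2)
    moreover have "\<psi> f = z" by (simp add: \<psi>_def f_def z wmod umod)
    ultimately show "z \<in> \<psi> ` carrier P" by blast
  next
    fix f assume f: "f \<in> carrier P" and one: "\<psi> f = \<one>"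
    have f01: "f 0 \<in> {0..<2}" "f (Suc 0) \<in> {0..<int (ord u)}"
      using ordu PiE_mem[OF f[unfolded P_def carrier_product_group], of 0]
        PiE_mem[OF f[unfolded P_def carrier_product_group], of "Suc 0"]
      by (simp_all add: carrier_integer_mod_group)
    have ext: "f \<in> extensional {..<length [2, ord u]}" using f by (auto simp: P_def PiE_iff)
    \<comment> \<open>A nonzero first coordinate would be 1 and would make \<open>w\<close> a power
      of \<open>u\<close>.\<close>
    have f0: "f 0 = 0"
    proof (rule ccontr)
      assume "f 0 \<noteq> 0"
      then have "f 0 = 1" using f01 by auto
      then have "w \<otimes> u [^] f (Suc 0) = \<one>" using one w by (simp add: \<psi>_def int_pow_1)
      then have "w = inv (u [^] f (Suc 0))" using w u by (metis int_pow_closed inv_equality)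
      then have "w = u [^] (- f (Suc 0))" using u by (simp add: int_pow_neg)
      then show False using wu generate_pow[OF u] by blast
    qed
    have "w [^] f 0 \<otimes> u [^] f (Suc 0) = \<one>" using one unfolding \<psi>_def .
    then have "u [^] f (Suc 0) = \<one>"
      unfolding f0 int_pow_0 l_one[OF int_pow_closed[OF u]] .
    then have "int (ord u) dvd f (Suc 0)" by (rule iffD1[OF int_pow_eq_id[OF u]])
    then have "f (Suc 0) = 0"
      using f01(2) zdvd_not_zless[of "f (Suc 0)" "int (ord u)"]
      by (metis atLeastLessThan_iff order_le_less)
    with f0 show "f = \<one>\<^bsub>P\<^esub>"
      by (intro extensionalityI[OF ext]) (auto simp: P_def lt2)
  qed
  then have "P \<cong> G" by (auto simp: is_iso_def)
  then have "G \<cong> P" by (rule group.iso_sym[OF gP])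
  then show ?thesis using fin comm_group_axioms by (simp add: of_type_def P_def)
qed

text \<open>With \<open>y\<close> a generator of the group and \<open>d\<close> the least positive
  exponent such that \<open>y [^] d\<close> lies in \<open>H\<close>, division with remainder shows
  that \<open>y [^] d\<close> generates \<open>H\<close>. The order of \<open>y\<close> guarantees
  that such an exponent exists.\<close>

lemma (in group) cyclic_subgroup:
  assumes fin: "finite (carrier G)" and cyc: "cyclic_group G" and H: "subgroup H G"
  shows "\<exists>h\<in>H. H = generate G {h}"
proof -
  obtain y where y: "y \<in> carrier G" "carrier G = range (\<lambda>n::int. y [^] n)"
    using cyc[unfolded cyclic_group] by (rule bexE)
  interpret H: subgroup H G by (rule H)
  have "y [^] ord y = \<one>" by (rule pow_ord_eq_1[OF y(1)])
  then have ex: "\<exists>n::nat. n > 0 \<and> y [^] n \<in> H" using ord_ge_1[OF fin y(1)] by (intro exI[of _ "ord y"]) simp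
  define d where "d = (LEAST n::nat. n > 0 \<and> y [^] n \<in> H)"
  have d: "d > 0" "y [^] d \<in> H" unfolding d_def using LeastI_ex[OF ex] by blast+
  have "g \<in> generate G {y [^] d}" if g: "g \<in> H" for g
  proof -
    obtain n :: int where n: "g = y [^] n" using g y(2) H.subset by blast
    define q where "q = n div int d"
    have dq: "y [^] (int d * q) = (y [^] d) [^] q"
      using int_pow_pow[OF y(1), of "int d" q] int_pow_int[of G y d] by simp
    define r where "r = nat (n mod int d)"
    have r: "r < d" "int r = n - int d * q"
      using d(1) by (simp_all add: r_def q_def nat_less_iff minus_mult_div_eq_mod)
    have "y [^] int r = g \<otimes> inv ((y [^] d) [^] q)"
      unfolding r(2) n using int_pow_diff[OF y(1), of n "int d * q"] dq by simp
    also have "\<dots> \<in> H"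
      by (rule H.m_closed[OF g H.m_inv_closed[OF subgroup_int_pow_closed[OF H d(2)]]])
    finally have "y [^] r \<in> H" unfolding int_pow_int .
    then have "r = 0" using r(1) not_less_Least[of r "\<lambda>n. n > 0 \<and> y [^] n \<in> H"] unfolding d_def
      by (metis gr0I)
    then have "n = int d * q" using r(2) by simp
    then have "g = (y [^] d) [^] q" using dq unfolding n by metis
    then show ?thesis using generate_pow[of "y [^] d"] y(1) by blast
  qed
  moreover have "generate G {y [^] d} \<subseteq> H"
    using generate_subgroup_incl[OF _ H, of "{y [^] d}"] d(2) by simp
  ultimately show ?thesis using d(2) by blast
qed

text \<open>Both \<open>N \<inter> H\<close> and the image of \<open>H\<close> in
  \<open>G Mod N\<close> are cyclic. A generator of the first and a lift to \<open>H\<close> of a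
  generator of the second generate \<open>H\<close>.\<close>

lemma (in group) metacyclic_subgroup_two_generated:
  assumes fin: "finite (carrier G)" and meta: "metacyclic_group G" and H: "subgroup H G"
  shows "\<exists>x\<in>H. \<exists>y\<in>H. H = generate G {x, y}"
proof -
  obtain N where N: "N \<lhd> G" and cN: "cyclic_group (G\<lparr>carrier := N\<rparr>)" and cQ: "cyclic_group (G Mod N)"
    using meta by (auto simp: metacyclic_group_def)
  interpret N: normal N G by fact
  interpret H: subgroup H G by fact
  interpret GN: group "G\<lparr>carrier := N\<rparr>" by (rule N.subgroup_is_group[OF is_group])
  interpret h: group_hom G "G Mod N" "\<lambda>x. N #> x" using coset_hom[OF N] .
  have "subgroup (N \<inter> H) (G\<lparr>carrier := N\<rparr>)"
    by (rule subgroup_incl[OF subgroups_Inter_pair[OF N.is_subgroup H] N.is_subgroup]) simp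
  moreover have "finite (carrier (G\<lparr>carrier := N\<rparr>))" using fin N.subset finite_subset by auto
  ultimately obtain x where x: "x \<in> N \<inter> H" "N \<inter> H = generate (G\<lparr>carrier := N\<rparr>) {x}"
    using GN.cyclic_subgroup[OF _ cN] by metis
  then have NH: "N \<inter> H = generate G {x}" using generate_consistent[OF _ N.is_subgroup, of "{x}"] by blast
  have "finite (carrier (G Mod N))" using fin by (simp add: carrier_FactGroup)
  moreover have "subgroup ((\<lambda>x. N #> x) ` H) (G Mod N)" by (rule h.subgroup_img_is_subgroup[OF H])
  ultimately obtain Y where Y: "Y \<in> (\<lambda>x. N #> x) ` H" "(\<lambda>x. N #> x) ` H = generate (G Mod N) {Y}"
    using h.H.cyclic_subgroup[OF _ cQ] by metis
  then obtain y where y: "y \<in> H" "Y = N #> y" by blast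
  have "g \<in> generate G {x, y}" if g: "g \<in> H" for g
  proof -
    \<comment> \<open>Some \<open>z\<close> in \<open>generate G {y}\<close> has the same coset as
      \<open>g\<close>; the remaining factor \<open>g \<otimes> inv z\<close> lies in
      \<open>N \<inter> H\<close>.\<close>
    have "N #> g \<in> (\<lambda>x. N #> x) ` generate G {y}"
    proof -
      have "(\<lambda>x. N #> x) ` H = (\<lambda>x. N #> x) ` generate G {y}"
        using h.generate_img[of "{y}"] y H.subset Y(2) by (simp add: subset_iff)
      then show ?thesis using g by blast
    qed
    then obtain z where z: "z \<in> generate G {y}" "N #> g = N #> z" by blast
    have zH: "z \<in> H" using z(1) y(1) generate_subgroup_incl[of "{y}" H] H by auto
    have G: "g \<in> carrier G" "z \<in> carrier G" using g zH H.subset by auto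
    have "g \<in> N #> z" using rcos_self[OF G(1) N.is_subgroup] z(2) by simp
    then have "g \<otimes> inv z \<in> N" by (rule N.rcos_module_imp[OF is_group G(2)])
    moreover have "g \<otimes> inv z \<in> H" using g zH by simp
    ultimately have "g \<otimes> inv z \<in> generate G {x, y}"
      using NH mono_generate[of "{x}" "{x, y}"] by blast
    moreover have "z \<in> generate G {x, y}" using z(1) mono_generate[of "{y}" "{x, y}"] by blast
    ultimately have "g \<otimes> inv z \<otimes> z \<in> generate G {x, y}" by (rule generate.eng)
    then show ?thesis using G by (simp add: m_assoc)
  qed
  moreover have "generate G {x, y} \<subseteq> H"
    by (rule generate_subgroup_incl[OF _ H]) (use x y in auto)
  ultimately show ?thesis using x y by blast
qed

text \<open>The assumption \<open>nc\<close> rules out the values 0 and 1 of the minimum, so two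
  generators, if they exist, are optimal.\<close>

lemma (in group) min_generators_eq_2_iff:
  assumes fin: "finite (carrier G)"
    and nc: "\<And>x. x \<in> carrier G \<Longrightarrow> generate G {x} \<noteq> carrier G"
  shows "min_generators G = 2 \<longleftrightarrow> (\<exists>x\<in>carrier G. \<exists>y\<in>carrier G. generate G {x, y} = carrier G)"
proof -
  define P where "P n \<longleftrightarrow> (\<exists>S. S \<subseteq> carrier G \<and> finite S \<and> card S = n \<and> generate G S = carrier G)" for n
  have least: "min_generators G = (LEAST n. P n)" by (simp add: min_generators_def P_def)
  \<comment> \<open>The whole carrier is a finite generating set, so the \<open>LEAST\<close> is
    attained.\<close>
  have "P (card (carrier G))"
    unfolding P_def using fin generate_incl[of "carrier G"] generate.incl[of _ "carrier G" G] by blast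
  then have P_least: "P (LEAST n. P n)" by (rule LeastI)
  have "generate G {\<one>} = {\<one>}" by (rule generate_one)
  then have ne: "carrier G \<noteq> {\<one>}" using nc[OF one_closed] by simp
  have not_small: "\<not> P 0" "\<not> P 1"
  proof -
    show "\<not> P 0" using ne generate_empty by (auto simp: P_def)
    show "\<not> P 1" using nc by (auto simp: P_def card_1_singleton_iff)
  qed
  show ?thesis
  proof
    assume "min_generators G = 2"
    then have "P 2" using P_least least by simp
    then show "\<exists>x\<in>carrier G. \<exists>y\<in>carrier G. generate G {x, y} = carrier G"
      by (auto simp: P_def card_2_iff)
  next
    assume "\<exists>x\<in>carrier G. \<exists>y\<in>carrier G. generate G {x, y} = carrier G"
    then obtain x y where xy: "x \<in> carrier G" "y \<in> carrier G" "generate G {x, y} = carrier G" by blast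
    then have "x \<noteq> y" using nc by auto
    then have "P 2" using xy unfolding P_def by (intro exI[of _ "{x, y}"]) auto
    then have "(LEAST n. P n) \<le> 2" by (rule Least_le)
    moreover have "(LEAST n. P n) \<noteq> 0" "(LEAST n. P n) \<noteq> 1" using P_least not_small by metis+
    ultimately show "min_generators G = 2" using least by linarith
  qed
qed

context group
begin

text \<open>Every commutator is a product of three squares:
  \<open>[x, y] = (x y)^2 (y^-1 x^-1 y)^2 (y^-1)^2\<close>.\<close>

lemma derived_subset_squares_generated:
  "derived G (carrier G) \<subseteq> squares_generated G (carrier G)"
  unfolding derived_def
proof (rule generate_subgroup_incl)
  show sg: "subgroup (squares_generated G (carrier G)) G"
    unfolding squares_generated_def by (rule generate_is_subgroup) auto
  show "derived_set G (carrier G) \<subseteq> squares_generated G (carrier G)"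
  proof clarify
    fix x y assume xy: "x \<in> carrier G" "y \<in> carrier G"
    let ?z = "inv y \<otimes> inv x \<otimes> y"
    have "x \<otimes> y \<otimes> inv x \<otimes> inv y
        = ((x \<otimes> y) \<otimes> (x \<otimes> y)) \<otimes> (?z \<otimes> ?z) \<otimes> (inv y \<otimes> inv y)"
      using xy by (simp add: m_assoc)
    moreover have "(x \<otimes> y) \<otimes> (x \<otimes> y) \<in> squares_generated G (carrier G)"
      "?z \<otimes> ?z \<in> squares_generated G (carrier G)" "inv y \<otimes> inv y \<in> squares_generated G (carrier G)"
      using xy by (intro square_mem_squares_generated; simp)+
    ultimately show "x \<otimes> y \<otimes> inv x \<otimes> inv y \<in> squares_generated G (carrier G)"
      using subgroup.m_closed[OF sg] by metis
  qed
qed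

text \<open>The version of \<open>of_type_pairE\<close> for representatives in \<open>G\<close>:
  equations in the quotient become memberships in \<open>N\<close>.\<close>

lemma of_type_quotient_pairE:
  assumes N: "N \<lhd> G" and ty: "of_type (G Mod N) [p, q]" and p: "p > 1" and q: "q > 1"
  obtains a b where "a \<in> carrier G" "b \<in> carrier G"
    "\<And>g. g \<in> carrier G \<Longrightarrow> \<exists>i j. \<exists>n\<in>N. g = n \<otimes> (a [^] (i::nat) \<otimes> b [^] (j::nat))"
    "\<And>i j. a [^] (i::nat) \<otimes> b [^] (j::nat) \<in> N \<longleftrightarrow> p dvd i \<and> q dvd j"
    "order G = p * q * card N"
proof -
  interpret N: normal N G by (rule N)
  obtain x y where xy: "x \<in> carrier (G Mod N)" "y \<in> carrier (G Mod N)"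
    and surj: "\<And>z. z \<in> carrier (G Mod N) \<Longrightarrow>
      \<exists>i j. z = x [^]\<^bsub>G Mod N\<^esub> (i::nat) \<otimes>\<^bsub>G Mod N\<^esub> y [^]\<^bsub>G Mod N\<^esub> (j::nat)"
    and ker: "\<And>i j. x [^]\<^bsub>G Mod N\<^esub> (i::nat) \<otimes>\<^bsub>G Mod N\<^esub> y [^]\<^bsub>G Mod N\<^esub> (j::nat) = \<one>\<^bsub>G Mod N\<^esub>
      \<longleftrightarrow> p dvd i \<and> q dvd j"
    and ord: "order (G Mod N) = p * q"
    by (rule of_type_pairE[OF ty p q]) (rule that)
  obtain a b where ab: "a \<in> carrier G" "x = N #> a" "b \<in> carrier G" "y = N #> b"
    using xy by (auto simp: carrier_FactGroup)
  interpret h: group_hom G "G Mod N" "\<lambda>x. N #> x" by (rule coset_hom[OF N])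
  have pow: "x [^]\<^bsub>G Mod N\<^esub> i \<otimes>\<^bsub>G Mod N\<^esub> y [^]\<^bsub>G Mod N\<^esub> j = N #> (a [^] i \<otimes> b [^] j)" for i j :: nat
    using ab h.hom_nat_pow[of a i] h.hom_nat_pow[of b j] h.hom_mult[of "a [^] i" "b [^] j"]
    by (simp only: nat_pow_closed)
  show thesis
  proof (rule that[OF ab(1,3)])
    fix g assume g: "g \<in> carrier G"
    then obtain i j :: nat where "N #> g = N #> (a [^] i \<otimes> b [^] j)"
      using surj[of "N #> g"] h.hom_closed[OF g] unfolding pow by blast
    then have "g \<in> N #> (a [^] i \<otimes> b [^] j)" using rcos_self[OF g N.is_subgroup] by simp
    then show "\<exists>i j. \<exists>n\<in>N. g = n \<otimes> (a [^] (i::nat) \<otimes> b [^] (j::nat))"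
      by (auto simp: r_coset_def)
  next
    fix i j :: nat
    show "a [^] i \<otimes> b [^] j \<in> N \<longleftrightarrow> p dvd i \<and> q dvd j"
      using ker[of i j] coset_eq_iff[OF N.is_subgroup, of "a [^] i \<otimes> b [^] j"] ab
      unfolding pow by simp
  next
    show "order G = p * q * card N"
      using lagrange[OF N.is_subgroup] ord by (simp add: order_def FactGroup_def)
  qed
qed

text \<open>The derived subgroup consists of products of squares, which are non-generators, so
  generating modulo it is enough.\<close>

lemma generate_eq_carrier_mod_derived:
  assumes ord: "order G = 2 ^ k" and S: "S \<subseteq> carrier G"
    and gen: "\<And>g. g \<in> carrier G \<Longrightarrow> \<exists>n\<in>derived G (carrier G). \<exists>s\<in>generate G S. g = n \<otimes> s"
  shows "generate G S = carrier G"
proof (rule two_group_generate_squares[OF ord generate_is_subgroup[OF S]])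
  fix K assume K: "subgroup K G" "generate G S \<subseteq> K" "squares_generated G (carrier G) \<subseteq> K"
  have "g \<in> K" if "g \<in> carrier G" for g
    using gen[OF that] K derived_subset_squares_generated subgroup.m_closed[OF K(1)] by blast
  then show "K = carrier G" using subgroup.subset[OF K(1)] by blast
qed

lemma nat_pow_mem_subgroup: "subgroup H G \<Longrightarrow> x \<in> H \<Longrightarrow> x [^] (n::nat) \<in> H"
  by (induction n) (auto intro: subgroup.one_closed subgroup.m_closed)

text \<open>Applied to \<open>M\<close>, this leads from the type of the abelianization to two
  generators of \<open>M\<close>.\<close>

lemma generate_pair_if_of_type:
  assumes ord: "order G = 2 ^ k" and ty: "of_type (G Mod derived G (carrier G)) [p, q]"
    and p: "p > 1" and q: "q > 1"
  shows "\<exists>x\<in>carrier G. \<exists>y\<in>carrier G. generate G {x, y} = carrier G"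
proof -
  obtain a b where ab: "a \<in> carrier G" "b \<in> carrier G"
    and gen: "\<And>g. g \<in> carrier G \<Longrightarrow>
      \<exists>i j. \<exists>n\<in>derived G (carrier G). g = n \<otimes> (a [^] (i::nat) \<otimes> b [^] (j::nat))"
    by (rule of_type_quotient_pairE[OF derived_self_is_normal ty p q]) (rule that)
  have S: "{a, b} \<subseteq> carrier G" using ab by simp
  have sg: "subgroup (generate G {a, b}) G" by (rule generate_is_subgroup[OF S])
  have "a \<in> generate G {a, b}" "b \<in> generate G {a, b}" by (simp_all add: generate.incl)
  then have "a [^] i \<otimes> b [^] j \<in> generate G {a, b}" for i j :: nat
    using nat_pow_mem_subgroup[OF sg] subgroup.m_closed[OF sg] by blast
  then have "generate G {a, b} = carrier G"
    by (intro generate_eq_carrier_mod_derived[OF ord S]) (use gen in blast)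
  then show ?thesis using ab by blast
qed

text \<open>The listed set is closed under left multiplication by \<open>x\<close> and by
  \<open>y\<close>, and its generators are their own inverses.\<close>

lemma generate_commuting_involutions:
  assumes XY: "x \<in> carrier G" "y \<in> carrier G" "x \<otimes> x = \<one>" "y \<otimes> y = \<one>" "y \<otimes> x = x \<otimes> y"
  shows "generate G {x, y} \<subseteq> {\<one>, x, y, x \<otimes> y}"
proof
  let ?V = "{\<one>, x, y, x \<otimes> y}"
  have XXY: "x \<otimes> (x \<otimes> y) = y" using XY by (simp flip: m_assoc)
  have "y \<otimes> (x \<otimes> y) = (y \<otimes> y) \<otimes> x" using XY(1,2) by (simp only: XY(5)[symmetric] m_assoc)
  then have YXY: "y \<otimes> (x \<otimes> y) = x" using XY by simp
  have mX: "x \<otimes> w \<in> ?V" and mY: "y \<otimes> w \<in> ?V" if "w \<in> ?V" for w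
    using that XY XXY YXY by auto
  fix z assume "z \<in> generate G {x, y}"
  then show "z \<in> ?V"
  proof induction
    case (inv g)
    then have "inv g = g" using XY by (auto intro: inv_equality)
    then show ?case using inv by auto
  next
    case (eng g1 g2)
    have g2: "g2 \<in> carrier G" using eng.IH(2) XY by auto
    have "(x \<otimes> y) \<otimes> g2 = x \<otimes> (y \<otimes> g2)" "\<one> \<otimes> g2 = g2" using XY g2 by (simp_all add: m_assoc)
    then show ?case using eng.IH mX mY by (elim insertE) simp_all
  qed auto
qed

text \<open>Modulo the squares every element is its own inverse, so the quotient is abelian and two
  generators give at most four cosets.\<close>

lemma two_generated_order_le:
  assumes fin: "finite (carrier G)" and xy: "x \<in> carrier G" "y \<in> carrier G"
    and gen: "generate G {x, y} = carrier G"
  shows "order G \<le> 4 * card (squares_generated G (carrier G))"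
proof -
  let ?P = "squares_generated G (carrier G)"
  have P: "?P \<lhd> G" by (rule squares_generated_normal[OF normal_self])
  have sP: "subgroup ?P G" by (rule normal_imp_subgroup[OF P])
  obtain Q :: "'a set monoid" and h where gh: "group_hom G Q h" and surj: "h ` carrier G = carrier Q"
    and ker: "\<And>x. x \<in> carrier G \<Longrightarrow> h x = \<one>\<^bsub>Q\<^esub> \<longleftrightarrow> x \<in> ?P"
    by (rule quotient_hom[OF P]) (rule that)
  interpret h: group_hom G Q h by (rule gh)
  have sq: "h z \<otimes>\<^bsub>Q\<^esub> h z = \<one>\<^bsub>Q\<^esub>" if "z \<in> carrier G" for z
    using ker[of "z \<otimes> z"] square_mem_squares_generated[OF that] that by simp
  have inv: "inv\<^bsub>Q\<^esub> h z = h z" if "z \<in> carrier G" for z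
    by (rule h.H.inv_equality[OF sq[OF that]]) (use that in auto)
  have "h (y \<otimes> x) = h y \<otimes>\<^bsub>Q\<^esub> h x" using xy by simp
  moreover have "inv\<^bsub>Q\<^esub> h (y \<otimes> x) = inv\<^bsub>Q\<^esub> h x \<otimes>\<^bsub>Q\<^esub> inv\<^bsub>Q\<^esub> h y"
    using xy h.H.inv_mult_group[of "h y" "h x"] by simp
  \<comment> \<open>Inverting \<open>h y\<close> times \<open>h x\<close> reverses the factors, yet
    leaves every element of \<open>Q\<close> unchanged.\<close>
  ultimately have comm: "h y \<otimes>\<^bsub>Q\<^esub> h x = h x \<otimes>\<^bsub>Q\<^esub> h y"
    using inv[of "y \<otimes> x"] inv xy by simp
  have "rcosets ?P \<subseteq> {?P #> \<one>, ?P #> x, ?P #> y, ?P #> (x \<otimes> y)}"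
  proof
    fix C assume "C \<in> rcosets ?P"
    then obtain z where z: "z \<in> carrier G" "C = ?P #> z" by (auto simp: RCOSETS_def)
    have "h z \<in> generate Q {h x, h y}"
      using h.generate_img[of "{x, y}"] xy gen z(1) by auto
    then have "h z \<in> {\<one>\<^bsub>Q\<^esub>, h x, h y, h x \<otimes>\<^bsub>Q\<^esub> h y}"
      using h.H.generate_commuting_involutions[OF h.hom_closed h.hom_closed sq sq comm] xy by blast
    then have "h z \<in> h ` {\<one>, x, y, x \<otimes> y}" using xy by simp
    then obtain t where t: "t \<in> {\<one>, x, y, x \<otimes> y}" "h z = h t" by blast
    have tG: "t \<in> carrier G" using t(1) xy by auto
    have "h (z \<otimes> inv t) = h t \<otimes>\<^bsub>Q\<^esub> inv\<^bsub>Q\<^esub> h t" using z(1) tG t(2) by simp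
    then have "h (z \<otimes> inv t) = \<one>\<^bsub>Q\<^esub>" using tG by simp
    then have "z \<otimes> inv t \<in> ?P" using ker[of "z \<otimes> inv t"] z(1) tG by blast
    then have "z \<in> ?P #> t" using subgroup.rcos_module_rev[OF sP is_group tG z(1)] by blast
    then have "?P #> t = ?P #> z" by (rule repr_independence[OF _ tG sP])
    then show "C \<in> {?P #> \<one>, ?P #> x, ?P #> y, ?P #> (x \<otimes> y)}" using t(1) z(2) by blast
  qed
  then have "card (rcosets ?P) \<le> card {?P #> \<one>, ?P #> x, ?P #> y, ?P #> (x \<otimes> y)}"
    by (intro card_mono) auto
  also have "\<dots> \<le> 4" by (simp add: card_insert_if)
  finally show ?thesis using lagrange[OF sP] by (metis mult_le_mono1)
qed

text \<open>A subgroup containing the derived subgroup is normal. Modulo the cyclic group generated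
  by \<open>t\<close>, the image of \<open>v\<close> alone generates.\<close>

lemma metacyclic_if_derived_subset:
  assumes tv: "t \<in> carrier G" "v \<in> carrier G" and gen: "generate G {t, v} = carrier G"
    and D: "derived G (carrier G) \<subseteq> generate G {t}"
  shows "metacyclic_group G"
proof -
  let ?N = "generate G {t}"
  have sN: "subgroup ?N G" using generate_is_subgroup tv by simp
  have N: "?N \<lhd> G"
  proof (rule normal_invI[OF sN])
    fix g x assume gx: "g \<in> carrier G" "x \<in> ?N"
    have xG: "x \<in> carrier G" using gx(2) subgroup.mem_carrier[OF sN] by blast
    have "g \<otimes> x \<otimes> inv g \<otimes> inv x \<in> derived G (carrier G)"
      unfolding derived_def by (rule generate.incl) (use gx xG in blast)
    then have "g \<otimes> x \<otimes> inv g \<otimes> inv x \<otimes> x \<in> ?N" using D gx(2) subgroup.m_closed[OF sN] by blast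
    then show "g \<otimes> x \<otimes> inv g \<in> ?N" using gx(1) xG by (simp add: m_assoc)
  qed
  interpret N: normal ?N G by (rule N)
  interpret h: group_hom G "G Mod ?N" "\<lambda>x. ?N #> x" by (rule coset_hom[OF N])
  interpret GN: group "G\<lparr>carrier := ?N\<rparr>" by (rule subgroup_imp_group[OF sN])
  have tN: "t \<in> ?N" by (simp add: generate.incl)
  have "cyclic_group (G\<lparr>carrier := ?N\<rparr>)"
    unfolding GN.cyclic_group
  proof (rule bexI[of _ t])
    have "carrier (G\<lparr>carrier := ?N\<rparr>) = generate (G\<lparr>carrier := ?N\<rparr>) {t}"
      using generate_consistent[OF _ sN, of "{t}"] tN by simp
    also have "\<dots> = range (\<lambda>n::int. t [^]\<^bsub>G\<lparr>carrier := ?N\<rparr>\<^esub> n)"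
      using GN.generate_pow[of t] tN by auto
    finally show "carrier (G\<lparr>carrier := ?N\<rparr>) = range (\<lambda>n::int. t [^]\<^bsub>G\<lparr>carrier := ?N\<rparr>\<^esub> n)" .
  qed (use tN in simp)
  moreover have "cyclic_group (G Mod ?N)"
    unfolding h.H.cyclic_group
  proof (rule bexI[of _ "?N #> v"])
    have v: "?N #> v \<in> carrier (G Mod ?N)" using h.hom_closed[OF tv(2)] .
    have "?N #> t = \<one>\<^bsub>G Mod ?N\<^esub>" using coset_eq_iff[OF sN tv(1)] tN by simp
    then have "(\<lambda>x. ?N #> x) ` {t, v} \<subseteq> generate (G Mod ?N) {?N #> v}"
      using generate.one[of "G Mod ?N"] generate.incl[of "?N #> v" "{?N #> v}" "G Mod ?N"] by simp
    then have "generate (G Mod ?N) ((\<lambda>x. ?N #> x) ` {t, v}) \<subseteq> generate (G Mod ?N) {?N #> v}"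
      by (rule h.H.generate_subgroup_incl[OF _ h.H.generate_is_subgroup]) (use v in simp)
    moreover have "carrier (G Mod ?N) = generate (G Mod ?N) ((\<lambda>x. ?N #> x) ` {t, v})"
      using h.generate_img[of "{t, v}"] tv gen by (simp add: carrier_FactGroup)
    moreover have "generate (G Mod ?N) {?N #> v} \<subseteq> carrier (G Mod ?N)"
      by (rule h.H.generate_incl) (use v in simp)
    ultimately have "carrier (G Mod ?N) = generate (G Mod ?N) {?N #> v}" by (metis subset_antisym)
    also have "\<dots> = range (\<lambda>n::int. (?N #> v) [^]\<^bsub>G Mod ?N\<^esub> n)"
      using h.H.generate_pow[OF v] by (simp add: full_SetCompr_eq)
    finally show "carrier (G Mod ?N) = range (\<lambda>n::int. (?N #> v) [^]\<^bsub>G Mod ?N\<^esub> n)" .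
  qed (use h.hom_closed[OF tv(2)] in blast)
  ultimately show ?thesis using N unfolding metacyclic_group_def by blast
qed

end

lemma (in comm_group) generate_pair_int_pow:
  assumes u: "u \<in> carrier G" and w: "w \<in> carrier G" and z: "z \<in> generate G {w, u}"
  shows "\<exists>(i::int) (j::int). z = w [^] i \<otimes> u [^] j"
  using z
proof induction
  case one
  show ?case by (intro exI[of _ 0]) simp
next
  case (incl g)
  then consider "g = w" | "g = u" by blast
  then show ?case
  proof cases
    case 1
    then show ?thesis using w by (intro exI[of _ 1] exI[of _ 0]) (simp add: int_pow_1)
  next
    case 2
    then show ?thesis using u by (intro exI[of _ 0] exI[of _ 1]) (simp add: int_pow_1)
  qed
next
  case (inv g)
  then consider "g = w" | "g = u" by blast
  then show ?case
  proof cases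
    case 1
    then show ?thesis using w by (intro exI[of _ "- 1"] exI[of _ 0]) (simp add: int_pow_neg int_pow_1)
  next
    case 2
    then show ?thesis using u by (intro exI[of _ 0] exI[of _ "- 1"]) (simp add: int_pow_neg int_pow_1)
  qed
next
  case (eng g1 g2)
  then obtain i j i' j' :: int where "g1 = w [^] i \<otimes> u [^] j" "g2 = w [^] i' \<otimes> u [^] j'" by blast
  then have "g1 \<otimes> g2 = w [^] (i + i') \<otimes> u [^] (j + j')"
    using u w by (simp add: int_pow_mult m_ac)
  then show ?case by blast
qed

context group
begin

text \<open>Modulo \<open>N\<close>, the generator \<open>w\<close> can be corrected by a power of
  \<open>u\<close> to an element squaring to the identity and lying outside the cyclic group of
  \<open>u\<close>. The order of \<open>u\<close> modulo \<open>N\<close> is a power of 2, and at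
  least 4 because \<open>u \<otimes> u\<close> is not in \<open>N\<close>.\<close>

lemma of_type_quotient_pairI:
  assumes ord: "order G = 2 ^ k" and u: "u \<in> carrier G" and w: "w \<in> carrier G"
    and gen: "generate G {w, u} = carrier G"
    and N: "N \<lhd> G" and comm: "comm_group (G Mod N)" and Nu: "N \<subseteq> generate G {u}"
    and wu: "w \<notin> generate G {u}" and ww: "w \<otimes> w \<in> generate G {u \<otimes> u}"
    and uu: "u \<otimes> u \<notin> N"
  shows "\<exists>m\<ge>2. of_type (G Mod N) [2, 2 ^ m]"
proof -
  define A where "A = G Mod N"
  define h where "h = (\<lambda>x. N #> x)"
  have hom_h: "group_hom G A h" unfolding A_def h_def by (rule coset_hom[OF N])
  interpret A: comm_group A unfolding A_def by (rule comm)
  interpret h: group_hom G A h by (rule hom_h)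
  interpret N: normal N G by (rule N)
  have surj: "h ` carrier G = carrier A" by (simp add: h_def A_def carrier_FactGroup)
  have ker: "h x = \<one>\<^bsub>A\<^esub> \<longleftrightarrow> x \<in> N" if "x \<in> carrier G" for x
    using coset_eq_iff[OF N.is_subgroup that] by (simp add: h_def A_def)
  have fin: "finite (carrier G)"
    using ord by (metis order_gt_0_iff_finite zero_less_numeral zero_less_power)
  have finA: "finite (carrier A)" using fin surj by (metis finite_imageI)
  have su: "subgroup (generate G {u}) G" using generate_is_subgroup u by simp
  have uuG: "u \<otimes> u \<in> carrier G" using u by simp
  obtain j :: int where j: "w \<otimes> w = (u \<otimes> u) [^] j"
    using ww generate_pow[OF uuG] by blast
  \<comment> \<open>As \<open>w \<otimes> w\<close> is the power \<open>j\<close> of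
    \<open>u \<otimes> u\<close>, dividing \<open>w\<close> by \<open>u [^] j\<close> kills its
    square in the abelian quotient.\<close>
  define v where "v = inv (u [^] j) \<otimes> w"
  have ujG: "u [^] j \<in> carrier G" using u by simp
  have vG: "v \<in> carrier G" using ujG w by (simp add: v_def)
  have uj: "u [^] j \<in> generate G {u}" using generate_pow[OF u] by blast
  have w_eq: "w = u [^] j \<otimes> v" using ujG w by (simp add: v_def)
  have U: "h u \<in> carrier A" and V: "h v \<in> carrier A" using u vG h.hom_closed by blast+
  have hw: "h w = h u [^]\<^bsub>A\<^esub> j \<otimes>\<^bsub>A\<^esub> h v"
    unfolding w_eq using h.hom_mult[OF ujG vG] h.hom_int_pow[OF u] by simp
  have VV: "h v \<otimes>\<^bsub>A\<^esub> h v = \<one>\<^bsub>A\<^esub>"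
  proof -
    have P: "h u [^]\<^bsub>A\<^esub> j \<in> carrier A" using U by simp
    have "h (w \<otimes> w) = (h u \<otimes>\<^bsub>A\<^esub> h u) [^]\<^bsub>A\<^esub> j"
      unfolding j using h.hom_int_pow[OF uuG] h.hom_mult[OF u u] by simp
    also have "\<dots> = h u [^]\<^bsub>A\<^esub> j \<otimes>\<^bsub>A\<^esub> h u [^]\<^bsub>A\<^esub> j"
      by (rule A.int_pow_distrib[OF U U])
    finally have "h w \<otimes>\<^bsub>A\<^esub> h w = h u [^]\<^bsub>A\<^esub> j \<otimes>\<^bsub>A\<^esub> h u [^]\<^bsub>A\<^esub> j"
      using h.hom_mult[OF w w] by simp
    then have "(h u [^]\<^bsub>A\<^esub> j \<otimes>\<^bsub>A\<^esub> h u [^]\<^bsub>A\<^esub> j) \<otimes>\<^bsub>A\<^esub> (h v \<otimes>\<^bsub>A\<^esub> h v)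
        = h u [^]\<^bsub>A\<^esub> j \<otimes>\<^bsub>A\<^esub> h u [^]\<^bsub>A\<^esub> j"
      unfolding hw using P V by (simp add: A.m_ac)
    moreover have "h u [^]\<^bsub>A\<^esub> j \<otimes>\<^bsub>A\<^esub> h u [^]\<^bsub>A\<^esub> j \<in> carrier A" "h v \<otimes>\<^bsub>A\<^esub> h v \<in> carrier A"
      using P V by (simp_all only: A.m_closed)
    ultimately show ?thesis by (simp only: A.l_cancel_one)
  qed
  \<comment> \<open>Because \<open>N\<close> lies in \<open>generate G {u}\<close>, a relation
    modulo \<open>N\<close> would put \<open>v\<close>, and then \<open>w\<close>, into
    \<open>generate G {u}\<close> itself.\<close>
  have VU: "h v \<notin> generate A {h u}"
  proof
    assume "h v \<in> generate A {h u}"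
    then have "h v \<in> h ` generate G {u}" using h.generate_img[of "{u}"] u by simp
    then obtain z where z: "z \<in> generate G {u}" "h v = h z" by blast
    have zG: "z \<in> carrier G" using z(1) subgroup.mem_carrier[OF su] by blast
    have "h (v \<otimes> inv z) = h z \<otimes>\<^bsub>A\<^esub> inv\<^bsub>A\<^esub> h z" using vG zG z(2) by simp
    then have "h (v \<otimes> inv z) = \<one>\<^bsub>A\<^esub>" using zG by simp
    then have "v \<otimes> inv z \<in> generate G {u}" using ker[of "v \<otimes> inv z"] vG zG Nu by blast
    then have "v \<otimes> inv z \<otimes> z \<in> generate G {u}" using z(1) by (rule generate.eng)
    then have "v \<in> generate G {u}" using vG zG by (simp add: m_assoc)
    then have "u [^] j \<otimes> v \<in> generate G {u}" by (rule generate.eng[OF uj])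
    then show False using wu w_eq by simp
  qed
  have A_gen: "\<exists>(i::int) (j::int). z = h v [^]\<^bsub>A\<^esub> i \<otimes>\<^bsub>A\<^esub> h u [^]\<^bsub>A\<^esub> j" if z: "z \<in> carrier A" for z
  proof (rule A.generate_pair_int_pow[OF U V])
    have sub: "subgroup (generate A {h v, h u}) A" using A.generate_is_subgroup U V by simp
    have "h u \<in> generate A {h v, h u}" "h v \<in> generate A {h v, h u}" by (simp_all add: generate.incl)
    moreover from this have "h w \<in> generate A {h v, h u}"
      unfolding hw using A.subgroup_int_pow_closed[OF sub] subgroup.m_closed[OF sub] by blast
    ultimately have "generate A {h w, h u} \<subseteq> generate A {h v, h u}"
      by (intro A.generate_subgroup_incl[OF _ sub]) simp
    moreover have "generate A {h w, h u} = carrier A"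
      using h.generate_img[of "{w, u}"] u w gen surj by simp
    ultimately show "z \<in> generate A {h v, h u}" using z by (simp add: subset_iff)
  qed
  have ty: "of_type A [2, A.ord (h u)]"
    by (rule A.of_type_pairI[OF finA V U VV VU A_gen])
  have "order A * card N = 2 ^ k"
    using lagrange[OF N.is_subgroup] ord by (simp add: A_def order_def FactGroup_def)
  then have "order A dvd 2 ^ k" by (metis dvd_triv_left)
  moreover have "A.ord (h u) dvd order A" using A.ord_dvd_group_order[OF U] .
  ultimately obtain m where m: "A.ord (h u) = 2 ^ m"
    using divides_primepow_nat[OF two_is_prime_nat] by (metis dvd_trans)
  have "m \<ge> 2"
  proof (rule ccontr)
    assume "\<not> m \<ge> 2"
    then have "m = 0 \<or> m = 1" by auto
    then have "A.ord (h u) dvd 2" using m by auto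
    then have "h u [^]\<^bsub>A\<^esub> (2::nat) = \<one>\<^bsub>A\<^esub>" using A.pow_eq_id[OF U, of 2] by simp
    then have "h (u \<otimes> u) = \<one>\<^bsub>A\<^esub>" using u U by (simp add: numeral_2_eq_2)
    then show False using ker[OF uuG] uu by simp
  qed
  then show ?thesis using ty m unfolding A_def by auto
qed

end

section \<open>The equivalence of the three conditions\<close>

lemma (in group_hom) image_generate_involution:
  assumes x: "x \<in> carrier G" "h x \<otimes>\<^bsub>H\<^esub> h x = \<one>\<^bsub>H\<^esub>" and z: "z \<in> generate G {x}"
  shows "h z = \<one>\<^bsub>H\<^esub> \<or> h z = h x"
  using z
proof induction
  case (inv g)
  then show ?case using x H.inv_equality[of "h x" "h x"] by simp
next
  case (eng g1 g2)
  then have "g1 \<in> carrier G" "g2 \<in> carrier G" using G.generate_in_carrier[of "{x}"] x(1) by auto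
  then have "h (g1 \<otimes> g2) = h g1 \<otimes>\<^bsub>H\<^esub> h g2" by (rule hom_mult)
  then show ?case using eng.IH x H.l_one H.r_one hom_closed[OF x(1)] by (elim disjE) (simp_all only: H.one_closed simp_thms)
qed simp_all

lemma of_type_2_2_square:
  assumes "of_type A [2, 2]" and z: "z \<in> carrier A"
  shows "z \<otimes>\<^bsub>A\<^esub> z = \<one>\<^bsub>A\<^esub>"
proof -
  interpret A: comm_group A using assms(1) by (simp add: of_type_def)
  obtain x y where xy: "x \<in> carrier A" "y \<in> carrier A"
    and surj: "\<And>z. z \<in> carrier A \<Longrightarrow> \<exists>i j. z = x [^]\<^bsub>A\<^esub> (i::nat) \<otimes>\<^bsub>A\<^esub> y [^]\<^bsub>A\<^esub> (j::nat)"
    and ker: "\<And>i j. x [^]\<^bsub>A\<^esub> (i::nat) \<otimes>\<^bsub>A\<^esub> y [^]\<^bsub>A\<^esub> (j::nat) = \<one>\<^bsub>A\<^esub> \<longleftrightarrow> 2 dvd i \<and> 2 dvd j"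
    by (rule of_type_pairE[OF assms(1)]) (simp, simp, rule that)
  obtain i j :: nat where "z = x [^]\<^bsub>A\<^esub> i \<otimes>\<^bsub>A\<^esub> y [^]\<^bsub>A\<^esub> j" using surj[OF z] by blast
  then have "z \<otimes>\<^bsub>A\<^esub> z = x [^]\<^bsub>A\<^esub> (i + i) \<otimes>\<^bsub>A\<^esub> y [^]\<^bsub>A\<^esub> (j + j)"
    using xy by (simp add: A.nat_pow_mult[symmetric] A.m_ac)
  also have "\<dots> = \<one>\<^bsub>A\<^esub>" unfolding ker by simp
  finally show ?thesis .
qed

text \<open>All conditions are compared with \<open>M\<close> being generated by two elements.
  Metacyclicity and the type condition each imply it, it implies both of them, and since
  \<open>M\<close> is not cyclic it amounts to \<open>d(M) = 2\<close>.\<close>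

lemma (in group) metacyclic_iff_maximal_subgroup_two_generated:
  assumes "finite (carrier G)"
    and "\<exists>k. order G = 2 ^ k"
    and "\<not> comm_group G"
    and "of_type (G Mod derived G (carrier G)) [2, 4]"
    and "maximal_subgroup M G"
    and "derived G (carrier G) \<subseteq> M"
    and "of_type (G\<lparr>carrier := M\<rparr> Mod derived G (carrier G)) [2, 2]"
  shows "(metacyclic_group G \<longleftrightarrow>
            (\<exists>m\<ge>2. of_type (G\<lparr>carrier := M\<rparr> Mod derived G M) [2, 2 ^ m])) \<and>
         ((\<exists>m\<ge>2. of_type (G\<lparr>carrier := M\<rparr> Mod derived G M) [2, 2 ^ m]) \<longleftrightarrow>
            min_generators (G\<lparr>carrier := M\<rparr>) = 2)"
proof -
  define D where "D = derived G (carrier G)"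
  define MG where "MG = G\<lparr>carrier := M\<rparr>"
  obtain k where ord: "order G = 2 ^ k" using assms(2) by blast
  have D: "D \<lhd> G" unfolding D_def by (rule derived_self_is_normal)
  interpret D: normal D G by (rule D)
  have sM: "subgroup M G" using assms(5) by (simp add: maximal_subgroup_def)
  interpret M: subgroup M G by (rule sM)
  interpret MG: group MG unfolding MG_def by (rule subgroup_imp_group[OF sM])
  have DM: "D \<subseteq> M" using assms(6) by (simp add: D_def)
  have finX: "finite (carrier MG)" using assms(1) M.subset finite_subset by (auto simp: MG_def)
  obtain k' where ordX: "order MG = 2 ^ k'"
    using card_subgroup_p_group[OF two_is_prime_nat ord sM] by (auto simp: MG_def order_def)
  have gen_X: "generate MG S = generate G S" if "S \<subseteq> M" for S
    unfolding MG_def by (rule generate_consistent[OF that sM])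
  have der_X: "derived MG (carrier MG) = derived G M"
    using derived_consistent[OF _ sM, of M] by (simp add: MG_def)
  have DX: "D \<lhd> MG" unfolding MG_def by (rule normal_restrict_supergroup[OF sM D DM])
  have tyG: "of_type (G Mod D) [2, 4]" and tyX: "of_type (MG Mod D) [2, 2]"
    using assms(4,7) by (simp_all add: D_def MG_def)
  obtain a b where ab: "a \<in> carrier G" "b \<in> carrier G"
    and cosets: "\<And>g. g \<in> carrier G \<Longrightarrow> \<exists>i j. \<exists>n\<in>D. g = n \<otimes> (a [^] (i::nat) \<otimes> b [^] (j::nat))"
    and mem_D: "\<And>i j. a [^] (i::nat) \<otimes> b [^] (j::nat) \<in> D \<longleftrightarrow> 2 dvd i \<and> 4 dvd j"
    by (rule of_type_quotient_pairE[OF D tyG]) (simp, simp, rule that)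
  have "order MG = 2 * 2 * card D"
    by (rule MG.of_type_quotient_pairE[OF DX tyX]) (simp, simp, assumption)
  then have card_M: "card M = 4 * card D" by (simp add: MG_def order_def)
  have S: "{a, b} \<subseteq> carrier G" using ab by simp
  have gen_ab: "generate G {a, b} = carrier G"
  proof (rule generate_eq_carrier_mod_derived[OF ord S])
    fix g assume "g \<in> carrier G"
    then obtain i j :: nat and n where n: "n \<in> D" "g = n \<otimes> (a [^] i \<otimes> b [^] j)"
      using cosets by blast
    have sg: "subgroup (generate G {a, b}) G" by (rule generate_is_subgroup[OF S])
    have "a \<in> generate G {a, b}" "b \<in> generate G {a, b}" by (simp_all add: generate.incl)
    then have "a [^] i \<otimes> b [^] j \<in> generate G {a, b}"
      using nat_pow_mem_subgroup[OF sg] subgroup.m_closed[OF sg] by blast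
    then show "\<exists>n\<in>derived G (carrier G). \<exists>s\<in>generate G {a, b}. g = n \<otimes> s"
      using n unfolding D_def by blast
  qed
  \<comment> \<open>Here \<open>Q\<close> stands for the abelianization of \<open>G\<close>, where
    relations between \<open>a\<close> and \<open>b\<close> are computed.\<close>
  obtain Q :: "'a set monoid" and h where gh: "group_hom G Q h" and surj: "h ` carrier G = carrier Q"
    and ker: "\<And>x. x \<in> carrier G \<Longrightarrow> h x = \<one>\<^bsub>Q\<^esub> \<longleftrightarrow> x \<in> D"
    by (rule quotient_hom[OF D]) (rule that)
  interpret h: group_hom G Q h by (rule gh)
  have comm_Q: "h x \<otimes>\<^bsub>Q\<^esub> h y = h y \<otimes>\<^bsub>Q\<^esub> h x" if "x \<in> carrier G" "y \<in> carrier G" for x y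
  proof -
    have "x \<otimes> y \<otimes> inv x \<otimes> inv y \<in> D"
      unfolding D_def derived_def by (rule generate.incl) (use that in blast)
    then have "h (x \<otimes> y \<otimes> inv x \<otimes> inv y) = \<one>\<^bsub>Q\<^esub>" using ker[of "x \<otimes> y \<otimes> inv x \<otimes> inv y"] that by simp
    then show ?thesis using h.H.commutator_eq_one_iff[of "h x" "h y"] that by simp
  qed
  interpret Q: comm_group Q
  proof (rule h.H.group_comm_groupI)
    fix x y assume "x \<in> carrier Q" "y \<in> carrier Q"
    then have "x \<in> h ` carrier G" "y \<in> h ` carrier G" by (simp_all only: surj)
    then show "x \<otimes>\<^bsub>Q\<^esub> y = y \<otimes>\<^bsub>Q\<^esub> x" using comm_Q by (elim imageE) (simp only:)
  qed
  have aG: "h a \<in> carrier Q" and bG: "h b \<in> carrier Q" using ab h.hom_closed by blast+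
  have h_pow: "h (a [^] i \<otimes> b [^] j) = h a [^]\<^bsub>Q\<^esub> i \<otimes>\<^bsub>Q\<^esub> h b [^]\<^bsub>Q\<^esub> j" for i j :: nat
    using ab by (simp add: h.hom_nat_pow)
  have pow_one: "h a [^]\<^bsub>Q\<^esub> i \<otimes>\<^bsub>Q\<^esub> h b [^]\<^bsub>Q\<^esub> j = \<one>\<^bsub>Q\<^esub> \<longleftrightarrow> 2 dvd i \<and> 4 dvd j" for i j :: nat
    using ker[of "a [^] i \<otimes> b [^] j"] mem_D[of i j] ab unfolding h_pow by simp
  have a2_one: "h a [^]\<^bsub>Q\<^esub> (2 * i :: nat) = \<one>\<^bsub>Q\<^esub>" for i
    using pow_one[of "2 * i" 0] aG by simp
  have b4_one: "h b [^]\<^bsub>Q\<^esub> (4 * j :: nat) = \<one>\<^bsub>Q\<^esub>" for j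
    using pow_one[of 0 "4 * j"] bG by simp
  have bbG: "b \<otimes> b \<in> carrier G" using ab by simp
  have a2: "a \<otimes> a \<in> D" using mem_D[of 2 0] ab by (simp add: numeral_2_eq_2)
  have bb_pow: "b [^] (2 * i :: nat) = (b \<otimes> b) [^] i" for i
    using ab nat_pow_pow[of b 2 i] by (simp add: numeral_2_eq_2)
  have b4: "(b \<otimes> b) \<otimes> (b \<otimes> b) \<in> D"
  proof -
    have "(b \<otimes> b) [^] (2::nat) = (b \<otimes> b) \<otimes> (b \<otimes> b)" using bbG by (simp add: numeral_2_eq_2)
    then show ?thesis using mem_D[of 0 4] ab bb_pow[of 2] by simp
  qed
  have a_nD: "a \<notin> D" using mem_D[of 1 0] ab by simp
  have bb_nD: "b \<otimes> b \<notin> D" using mem_D[of 0 2] ab bb_pow[of 1] by simp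
  have abb_nD: "a \<otimes> (b \<otimes> b) \<notin> D" using mem_D[of 1 2] ab bb_pow[of 1] by simp
  have sq_D: "x \<otimes> x \<in> D" if "x \<in> M" for x
  proof -
    have "x \<in> carrier MG" using that by (simp add: MG_def)
    then have "D #>\<^bsub>MG\<^esub> x \<in> carrier (MG Mod D)" by (auto simp: carrier_FactGroup)
    then have "(D #>\<^bsub>MG\<^esub> x) \<otimes>\<^bsub>MG Mod D\<^esub> (D #>\<^bsub>MG\<^esub> x) = \<one>\<^bsub>MG Mod D\<^esub>"
      by (rule of_type_2_2_square[OF tyX])
    then have "D #>\<^bsub>MG\<^esub> (x \<otimes>\<^bsub>MG\<^esub> x) = D"
      using group_hom.hom_mult[OF MG.coset_hom[OF DX] \<open>x \<in> carrier MG\<close> \<open>x \<in> carrier MG\<close>] by simp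
    then have "x \<otimes>\<^bsub>MG\<^esub> x \<in> D"
      using MG.coset_eq_iff[OF normal_imp_subgroup[OF DX], of "x \<otimes>\<^bsub>MG\<^esub> x"] \<open>x \<in> carrier MG\<close> by simp
    then show ?thesis by (simp add: MG_def)
  qed
  \<comment> \<open>The set on the right is a subgroup since \<open>Q\<close> is abelian; it
    contains \<open>M\<close> and misses \<open>b\<close>, so maximality makes it equal to
    \<open>M\<close>. This places \<open>a\<close> and \<open>b \<otimes> b\<close> in
    \<open>M\<close>, whatever lifts were chosen.\<close>
  have M_eq: "M = {x \<in> carrier G. x \<otimes> x \<in> D}"
  proof -
    let ?U = "{x \<in> carrier G. x \<otimes> x \<in> D}"
    have U_iff: "x \<in> ?U \<longleftrightarrow> x \<in> carrier G \<and> h x \<otimes>\<^bsub>Q\<^esub> h x = \<one>\<^bsub>Q\<^esub>" for x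
    proof (cases "x \<in> carrier G")
      case True
      have "h (x \<otimes> x) = \<one>\<^bsub>Q\<^esub> \<longleftrightarrow> x \<otimes> x \<in> D" by (rule ker) (use True in simp)
      then show ?thesis unfolding h.hom_mult[OF True True] using True by blast
    qed blast
    have "subgroup ?U G"
    proof (rule subgroupI)
      show "?U \<noteq> {}" using D.one_closed by auto
      show "inv x \<in> ?U" if "x \<in> ?U" for x
      proof -
        have x: "x \<in> carrier G" "x \<otimes> x \<in> D" using that by auto
        then have "inv (x \<otimes> x) \<in> D" by simp
        then show ?thesis using x(1) inv_mult_group[OF x(1) x(1)] by simp
      qed
      show "x \<otimes> y \<in> ?U" if "x \<in> ?U" "y \<in> ?U" for x y
      proof -
        have G: "x \<in> carrier G" "y \<in> carrier G" using that by auto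
        have "h (x \<otimes> y) \<otimes>\<^bsub>Q\<^esub> h (x \<otimes> y) = (h x \<otimes>\<^bsub>Q\<^esub> h x) \<otimes>\<^bsub>Q\<^esub> (h y \<otimes>\<^bsub>Q\<^esub> h y)"
          using G by (simp add: Q.m_ac)
        then show ?thesis using that unfolding U_iff by simp
      qed
    qed auto
    moreover have "M \<subseteq> ?U" using sq_D M.subset by auto
    moreover have "?U \<noteq> carrier G" using bb_nD ab by auto
    ultimately show ?thesis using assms(5) unfolding maximal_subgroup_def by blast
  qed
  have aM: "a \<in> M" by (subst M_eq) (use a2 ab in blast)
  have bbM: "b \<otimes> b \<in> M" by (subst M_eq) (use b4 bbG in blast)
  have M_cosets: "\<exists>d\<in>D. x \<in> {d, a \<otimes> d, (b \<otimes> b) \<otimes> d, a \<otimes> (b \<otimes> b) \<otimes> d}" if x: "x \<in> M" for x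
  proof -
    have xG: "x \<in> carrier G" using x M.subset by blast
    obtain i j :: nat and n where n: "n \<in> D" "x = n \<otimes> (a [^] i \<otimes> b [^] j)"
      using cosets[OF xG] by blast
    have "h x = h n \<otimes>\<^bsub>Q\<^esub> h (a [^] i \<otimes> b [^] j)" unfolding n(2) using n(1) D.subset ab by simp
    then have hx: "h x = h a [^]\<^bsub>Q\<^esub> i \<otimes>\<^bsub>Q\<^esub> h b [^]\<^bsub>Q\<^esub> j"
      using ker[of n] n(1) D.subset aG bG unfolding h_pow by auto
    have "h (x \<otimes> x) = h a [^]\<^bsub>Q\<^esub> (i + i) \<otimes>\<^bsub>Q\<^esub> h b [^]\<^bsub>Q\<^esub> (j + j)"
      using xG aG bG by (simp add: hx h.H.nat_pow_mult[symmetric] Q.m_ac)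
    moreover have "h (x \<otimes> x) = \<one>\<^bsub>Q\<^esub>" using ker[of "x \<otimes> x"] sq_D[OF x] xG by blast
    ultimately have "4 dvd j + j" using pow_one[of "i + i" "j + j"] by simp
    \<comment> \<open>Hence \<open>j\<close> is even, so modulo \<open>D\<close> only the exponents
      0 and 2 of \<open>b\<close> remain, and 0 and 1 of \<open>a\<close>: four cosets.\<close>
    then have j: "j = 4 * (j div 4) + 2 * (j div 2 mod 2)" by presburger
    have i: "i = 2 * (i div 2) + i mod 2" by simp
    have hai: "h a [^]\<^bsub>Q\<^esub> i = h a [^]\<^bsub>Q\<^esub> (i mod 2)"
      using h.H.nat_pow_mult[OF aG, of "2 * (i div 2)" "i mod 2"] aG unfolding a2_one i[symmetric] by simp
    have hbj: "h b [^]\<^bsub>Q\<^esub> j = h b [^]\<^bsub>Q\<^esub> (2 * (j div 2 mod 2))"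
      using h.H.nat_pow_mult[OF bG, of "4 * (j div 4)" "2 * (j div 2 mod 2)"] bG
      unfolding b4_one j[symmetric] by simp
    define t where "t = a [^] (i mod 2) \<otimes> (b \<otimes> b) [^] (j div 2 mod 2)"
    have tG: "t \<in> carrier G" using ab by (simp add: t_def)
    have "h x = h t" unfolding t_def hx hai hbj bb_pow[symmetric] h_pow ..
    then have "h (inv t \<otimes> x) = \<one>\<^bsub>Q\<^esub>" using xG tG by simp
    then have "inv t \<otimes> x \<in> D" using ker[of "inv t \<otimes> x"] xG tG by blast
    moreover have "x = t \<otimes> (inv t \<otimes> x)" using xG tG by simp
    moreover have "t \<in> {\<one>, a, b \<otimes> b, a \<otimes> (b \<otimes> b)}"
    proof -
      have "i mod 2 = 0 \<or> i mod 2 = 1" "j div 2 mod 2 = 0 \<or> j div 2 mod 2 = 1" by auto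
      then show ?thesis unfolding t_def using ab by (elim disjE) simp_all
    qed
    ultimately obtain d where "d \<in> D" "x = t \<otimes> d" "t \<in> {\<one>, a, b \<otimes> b, a \<otimes> (b \<otimes> b)}" by blast
    then show ?thesis using D.subset by auto
  qed
  interpret T: two_group_type_2_4 G k a b M
    by (intro two_group_type_2_4.intro two_group_type_2_4_axioms.intro is_group ord ab gen_ab
        a2[unfolded D_def] b4[unfolded D_def] M.subset M_cosets[unfolded D_def])
  have involutions_differ: "h x \<noteq> h y"
    if "x \<in> carrier G" "y \<in> carrier G" "x \<otimes> x \<in> D" "x \<otimes> y \<notin> D" for x y
  proof
    assume "h x = h y"
    then have "h (x \<otimes> y) = h (x \<otimes> x)" using that by simp
    then show False using ker[of "x \<otimes> y"] ker[of "x \<otimes> x"] that by simp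
  qed
  \<comment> \<open>The image of \<open>generate G {x}\<close> in \<open>Q\<close> has at most the
    two elements \<open>\<one>\<close> and \<open>h x\<close>, and \<open>h y\<close> is
    neither.\<close>
  have not_mem_generate: "y \<notin> generate G {x}"
    if "x \<in> carrier G" "y \<in> carrier G" "x \<otimes> x \<in> D" "x \<otimes> y \<notin> D" "y \<notin> D" for x y
  proof
    assume y: "y \<in> generate G {x}"
    have "h x \<otimes>\<^bsub>Q\<^esub> h x = \<one>\<^bsub>Q\<^esub>" using ker[of "x \<otimes> x"] that by simp
    then have "h y = \<one>\<^bsub>Q\<^esub> \<or> h y = h x" by (rule h.image_generate_involution[OF that(1) _ y])
    then show False using ker[OF that(2)] that involutions_differ[OF that(1-4)] by metis
  qed
  have bba: "(b \<otimes> b) \<otimes> a \<notin> D"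
  proof -
    have "h ((b \<otimes> b) \<otimes> a) = h (a \<otimes> (b \<otimes> b))"
      unfolding h.hom_mult[OF bbG ab(1)] h.hom_mult[OF ab(1) bbG] by (rule comm_Q[OF bbG ab(1)])
    then show ?thesis using ker[of "(b \<otimes> b) \<otimes> a"] ker[of "a \<otimes> (b \<otimes> b)"] abb_nD ab by simp
  qed
  \<comment> \<open>If \<open>M\<close> were cyclic, its image in \<open>Q\<close> would have at
    most one nontrivial element, but \<open>h a\<close> and \<open>h (b \<otimes> b)\<close> are
    two.\<close>
  have not_cyclic: "generate MG {x} \<noteq> carrier MG" if "x \<in> carrier MG" for x
  proof
    assume eq: "generate MG {x} = carrier MG"
    have xM: "x \<in> M" using that by (simp add: MG_def)
    have xG: "x \<in> carrier G" using xM M.subset by blast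
    have mem: "a \<in> generate G {x}" "b \<otimes> b \<in> generate G {x}"
      using eq gen_X[of "{x}"] xM aM bbM by (auto simp: MG_def)
    have "h x \<otimes>\<^bsub>Q\<^esub> h x = \<one>\<^bsub>Q\<^esub>" using ker[of "x \<otimes> x"] sq_D[OF xM] xG by simp
    then have "h a = \<one>\<^bsub>Q\<^esub> \<or> h a = h x" "h (b \<otimes> b) = \<one>\<^bsub>Q\<^esub> \<or> h (b \<otimes> b) = h x"
      using h.image_generate_involution[OF xG] mem by blast+
    then have "h a = h (b \<otimes> b)" using ker[OF ab(1)] ker[OF bbG] a_nD bb_nD by metis
    then show False using involutions_differ[OF ab(1) bbG a2 abb_nD] by blast
  qed
  let ?two_gen = "\<exists>x\<in>carrier MG. \<exists>y\<in>carrier MG. generate MG {x, y} = carrier MG"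
  let ?type = "\<exists>m\<ge>2. of_type (MG Mod derived G M) [2, 2 ^ m]"
  have min_gen: "min_generators MG = 2 \<longleftrightarrow> ?two_gen"
    by (rule MG.min_generators_eq_2_iff[OF finX not_cyclic])
  have meta_imp: "?two_gen" if "metacyclic_group G"
  proof -
    obtain x y where xy: "x \<in> M" "y \<in> M" "M = generate G {x, y}"
      using metacyclic_subgroup_two_generated[OF assms(1) \<open>metacyclic_group G\<close> sM] by blast
    then show ?thesis using gen_X[of "{x, y}"] by (auto simp: MG_def)
  qed
  have type_imp: "?two_gen" if ?type
  proof -
    obtain m where m: "m \<ge> 2" "of_type (MG Mod derived G M) [2, 2 ^ m]" using \<open>?type\<close> by blast
    have "(1::nat) < 2 ^ m" using m(1) by (intro one_less_power) auto
    then show ?thesis using MG.generate_pair_if_of_type[OF ordX, of 2 "2 ^ m"] m(2) der_X by simp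
  qed
  have two_gen_imp: "metacyclic_group G \<and> ?type" if ?two_gen
  proof -
    obtain x y where xy: "x \<in> carrier MG" "y \<in> carrier MG" "generate MG {x, y} = carrier MG"
      using \<open>?two_gen\<close> by blast
    let ?P = "squares_generated G M"
    have P_X: "squares_generated MG (carrier MG) = ?P"
      using squares_generated_consistent[OF sM] by (simp add: MG_def)
    have "?P \<subseteq> D"
      unfolding squares_generated_def
      by (rule generate_subgroup_incl[OF _ D.is_subgroup]) (use sq_D in blast)
    \<comment> \<open>Two generators bound \<open>card M\<close> by \<open>4 * card ?P\<close>,
      whereas \<open>card M = 4 * card D\<close>.\<close>
    moreover have "card D \<le> card ?P"
      using MG.two_generated_order_le[OF finX xy] card_M by (simp add: P_X) (simp add: MG_def order_def)
    moreover have "finite D" using assms(1) D.subset finite_subset by blast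
    ultimately have "?P = D" by (intro card_seteq)
    then have DP: "derived G (carrier G) \<subseteq> ?P" by (simp add: D_def)
    obtain s where s: "s \<in> {a \<otimes> a, (b \<otimes> b) \<otimes> (b \<otimes> b)}" "generate G {s} = D"
      using T.derived_cyclic(1)[OF DP] by (auto simp: D_def)
    have "D \<noteq> {\<one>}"
    proof
      assume "D = {\<one>}"
      have "comm_group G"
      proof (rule group_comm_groupI)
        fix x y assume xy: "x \<in> carrier G" "y \<in> carrier G"
        have "x \<otimes> y \<otimes> inv x \<otimes> inv y \<in> D"
          unfolding D_def by (rule T.commutator_mem_D[OF xy])
        then show "x \<otimes> y = y \<otimes> x" using \<open>D = {\<one>}\<close> commutator_eq_one_iff[OF xy] by simp
      qed
      then show False using assms(3) by simp
    qed
    then have \<Phi>: "squares_generated G D \<noteq> D" using T.\<Phi>_neq_D by (simp add: D_def)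
    have der_\<Phi>: "derived G M \<subseteq> squares_generated G D" using T.derived_cyclic(2)[OF DP] by (simp add: D_def)
    \<comment> \<open>Otherwise \<open>D\<close>, being generated by \<open>s\<close>, would be
      contained in its own Frattini subgroup.\<close>
    have s_nder: "s \<notin> derived G M"
    proof
      assume "s \<in> derived G M"
      then have "{s} \<subseteq> squares_generated G D" using der_\<Phi> by blast
      then have "generate G {s} \<subseteq> squares_generated G D"
        by (rule generate_subgroup_incl[OF _ normal_imp_subgroup[OF squares_generated_normal[OF D]]])
      then have "D \<subseteq> squares_generated G D" by (simp only: s(2))
      then show False using \<Phi> squares_generated_subset[OF D.is_subgroup] by blast
    qed
    \<comment> \<open>To be used with \<open>u\<close>, \<open>w\<close> equal to \<open>a\<close>,
      \<open>b \<otimes> b\<close> in the order for which \<open>s\<close> is the square of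
      \<open>u\<close>.\<close>
    have type: ?type if uw: "u \<in> M" "w \<in> M" "s = u \<otimes> u" "u \<otimes> w \<notin> D" "w \<notin> D"
      and M_gen: "M \<subseteq> generate G {w, u}" for u w
    proof -
      have G: "u \<in> carrier G" "w \<in> carrier G" using uw M.subset by auto
      have sX: "{u} \<subseteq> M" "{w, u} \<subseteq> M" "{u \<otimes> u} \<subseteq> M" using uw by auto
      have Du: "D \<subseteq> generate G {u}"
      proof -
        have "u \<otimes> u \<in> generate G {u}" by (intro generate.eng generate.incl) simp_all
        then show ?thesis
          unfolding s(2)[symmetric] uw(3) using G
          by (intro generate_subgroup_incl generate_is_subgroup) simp_all
      qed
      have der_D: "derived G M \<subseteq> D" using der_\<Phi> squares_generated_subset[OF D.is_subgroup] by blast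
      have "\<exists>m\<ge>2. of_type (MG Mod derived G M) [2, 2 ^ m]"
      proof (rule MG.of_type_quotient_pairI[OF ordX, of u w])
        show "u \<in> carrier MG" "w \<in> carrier MG" using uw by (simp_all add: MG_def)
        show "generate MG {w, u} = carrier MG"
          using gen_X[OF sX(2)] M_gen generate_subgroup_incl[OF sX(2) sM] by (auto simp: MG_def)
        show "derived G M \<lhd> MG" unfolding MG_def by (rule derived_subgroup_is_normal[OF sM])
        show "comm_group (MG Mod derived G M)"
          unfolding MG_def by (rule derived_quot_of_subgroup_is_comm_group[OF sM])
        show "derived G M \<subseteq> generate MG {u}" using der_D Du gen_X[OF sX(1)] by blast
        show "w \<notin> generate MG {u}"
          unfolding gen_X[OF sX(1)] by (rule not_mem_generate) (use uw G sq_D in auto)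
        have "generate MG {u \<otimes> u} = D" using gen_X[OF sX(3)] s(2) uw(3) by simp
        then show "w \<otimes>\<^bsub>MG\<^esub> w \<in> generate MG {u \<otimes>\<^bsub>MG\<^esub> u}" using sq_D[OF uw(2)] by (simp add: MG_def)
        show "u \<otimes>\<^bsub>MG\<^esub> u \<notin> derived G M" using s_nder uw(3) by (simp add: MG_def)
      qed
      then show ?thesis .
    qed
    have M_gen: "M \<subseteq> generate G {a, b \<otimes> b}"
    proof
      fix z assume "z \<in> M"
      then obtain d where d: "d \<in> D" "z \<in> {d, a \<otimes> d, (b \<otimes> b) \<otimes> d, a \<otimes> (b \<otimes> b) \<otimes> d}"
        using M_cosets by blast
      have sg: "subgroup (generate G {a, b \<otimes> b}) G" using ab by (intro generate_is_subgroup) simp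
      have mem: "a \<in> generate G {a, b \<otimes> b}" "b \<otimes> b \<in> generate G {a, b \<otimes> b}"
        by (simp_all add: generate.incl)
      then have "s \<in> generate G {a, b \<otimes> b}" using s(1) subgroup.m_closed[OF sg] by blast
      then have "generate G {s} \<subseteq> generate G {a, b \<otimes> b}"
        by (intro generate_subgroup_incl[OF _ sg]) simp
      then have "d \<in> generate G {a, b \<otimes> b}" using d(1) s(2) by blast
      then show "z \<in> generate G {a, b \<otimes> b}" using d(2) mem subgroup.m_closed[OF sg] by blast
    qed
    have sub_gen: "D \<subseteq> generate G {t}" if "t \<in> carrier G" "s \<in> generate G {t}" for t
      unfolding s(2)[symmetric] using that
      by (intro generate_subgroup_incl generate_is_subgroup) simp_all
    \<comment> \<open>Since \<open>s\<close> is a power of \<open>a\<close> or of \<open>b\<close>,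
      the cyclic group of that element contains \<open>D\<close>, and the remaining generator of
      \<open>G\<close> generates the quotient.\<close>
    consider "s = a \<otimes> a" | "s = (b \<otimes> b) \<otimes> (b \<otimes> b)" using s(1) by blast
    then show ?thesis
    proof cases
      case 1
      have "a \<otimes> a \<in> generate G {a}" by (intro generate.eng generate.incl) simp_all
      then have "D \<subseteq> generate G {a}" using sub_gen ab 1 by blast
      then have "metacyclic_group G"
        using metacyclic_if_derived_subset[OF ab gen_ab] by (simp add: D_def)
      moreover have ?type
        by (rule type[OF aM bbM 1 abb_nD bb_nD]) (use M_gen in \<open>simp add: insert_commute\<close>)
      ultimately show ?thesis ..
    next
      case 2
      have "(b \<otimes> b) \<otimes> (b \<otimes> b) \<in> generate G {b}" by (intro generate.eng generate.incl) simp_all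
      then have "D \<subseteq> generate G {b}" using sub_gen ab 2 by blast
      then have "metacyclic_group G"
        using metacyclic_if_derived_subset[OF ab(2,1)] gen_ab by (simp add: D_def insert_commute)
      moreover have ?type by (rule type[OF bbM aM 2 bba a_nD M_gen])
      ultimately show ?thesis ..
    qed
  qed
  have "(metacyclic_group G \<longleftrightarrow> ?type) \<and> (?type \<longleftrightarrow> min_generators MG = 2)"
    using min_gen meta_imp type_imp two_gen_imp by blast
  then show ?thesis unfolding MG_def .
qed

theorem mainTheorem3:
  fixes G :: "('a, 'b) monoid_scheme" and M :: "'a set"
  assumes "group G"
    and "finite (carrier G)"
    and "\<exists>k. order G = 2 ^ k"
    and "\<not> comm_group G"
    and "of_type (G Mod derived G (carrier G)) [2, 4]"
    and "maximal_subgroup M G"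
    and "derived G (carrier G) \<subseteq> M"
    and "of_type (G\<lparr>carrier := M\<rparr> Mod derived G (carrier G)) [2, 2]"
  shows "(metacyclic_group G \<longleftrightarrow>
            (\<exists>m\<ge>2. of_type (G\<lparr>carrier := M\<rparr> Mod derived G M) [2, 2 ^ m])) \<and>
         ((\<exists>m\<ge>2. of_type (G\<lparr>carrier := M\<rparr> Mod derived G M) [2, 2 ^ m]) \<longleftrightarrow>
            min_generators (G\<lparr>carrier := M\<rparr>) = 2)"
  by (rule group.metacyclic_iff_maximal_subgroup_two_generated[OF assms])

end
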